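(* The set of weakly Demuth random reals is not a boldface $\mathbf{\Sigma}^0_3$ subset of $2^\omega$ (i.e. it is not a $G_{\delta\sigma}$ set).
   Context: A Demuth test is a sequence $(S_m)$ of c.e. open subsets of $2^\omega$ with $\lambda(S_m)\le 2^{-m}$ and $S_m=[W_{f(m)}]^\prec$ for a function $f(m)=\lim_t g(m,t)$ with $g$ computable and the number of changes at $m$ computably bounded. A real $Z$ is weakly Demuth random if for every Demuth test there is some $m$ with $Z\notin S_m$. *)

theory Defs
  imports "HOL-Probability.Probability" "HOL-Library.Nat_Bijection"
begin

datatype recf = Zero | Succ | Proj nat | Comp recf "recf list" | PrimRec recf recf | Minim recf

inductive eval :: "recf \<Rightarrow> nat list \<Rightarrow> nat \<Rightarrow> bool" where
  zero: "eval Zero xs 0"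
| succ: "eval Succ (x # xs) (Suc x)"
| proj: "i < length xs \<Longrightarrow> eval (Proj i) xs (xs ! i)"
| comp: "list_all2 (\<lambda>g y. eval g xs y) gs ys \<Longrightarrow> eval f ys z \<Longrightarrow> eval (Comp f gs) xs z"
| pr0: "eval f xs y \<Longrightarrow> eval (PrimRec f g) (0 # xs) y"
| prS: "eval (PrimRec f g) (n # xs) y \<Longrightarrow> eval g (y # n # xs) z \<Longrightarrow> eval (PrimRec f g) (Suc n # xs) z"
| minim: "eval f (n # xs) 0 \<Longrightarrow> (\<forall>k<n. \<exists>y. eval f (k # xs) y \<and> y > 0) \<Longrightarrow> eval (Minim f) xs n"

fun enc :: "recf \<Rightarrow> nat" where
  "enc Zero = prod_encode (0, 0)"
| "enc Succ = prod_encode (1, 0)"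
| "enc (Proj i) = prod_encode (2, i)"
| "enc (Comp f gs) = prod_encode (3, prod_encode (enc f, list_encode (map enc gs)))"
| "enc (PrimRec f g) = prod_encode (4, prod_encode (enc f, enc g))"
| "enc (Minim f) = prod_encode (5, enc f)"

text \<open>Binary strings coded as natural numbers (computable bijection).\<close>
fun scode :: "bool list \<Rightarrow> nat" where
  "scode [] = 0"
| "scode (b # s) = 2 * scode s + (if b then 2 else 1)"

text \<open>The e-th c.e. set of strings W_e (empty if e codes no program).\<close>
definition W :: "nat \<Rightarrow> bool list set" where
  "W e = {\<sigma>. \<exists>c. enc c = e \<and> (\<exists>y. eval c [scode \<sigma>] y)}"

definition computable1 :: "(nat \<Rightarrow> nat) \<Rightarrow> bool" where
  "computable1 h \<longleftrightarrow> (\<exists>c. \<forall>x. eval c [x] (h x))"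

definition computable2 :: "(nat \<Rightarrow> nat \<Rightarrow> nat) \<Rightarrow> bool" where
  "computable2 g \<longleftrightarrow> (\<exists>c. \<forall>x y. eval c [x, y] (g x y))"

definition cyl :: "bool list set \<Rightarrow> (nat \<Rightarrow> bool) set" where
  "cyl U = {Z. \<exists>\<sigma>\<in>U. \<forall>i<length \<sigma>. Z i = \<sigma> ! i}"

definition lam :: "(nat \<Rightarrow> bool) measure" where
  "lam = PiM UNIV (\<lambda>_. measure_pmf (bernoulli_pmf (1/2)))"

definition cantor_top :: "(nat \<Rightarrow> bool) topology" where
  "cantor_top = product_topology (\<lambda>_. discrete_topology (UNIV :: bool set)) UNIV"

definition boldface_Sigma03 :: "(nat \<Rightarrow> bool) set \<Rightarrow> bool" where
  "boldface_Sigma03 A \<longleftrightarrow>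
     (\<exists>F :: nat \<Rightarrow> nat \<Rightarrow> (nat \<Rightarrow> bool) set.
        (\<forall>i j. openin cantor_top (F i j)) \<and> A = (\<Union>i. \<Inter>j. F i j))"

definition demuth_test :: "(nat \<Rightarrow> (nat \<Rightarrow> bool) set) \<Rightarrow> bool" where
  "demuth_test S \<longleftrightarrow>
     (\<exists>f g h. computable2 g \<and> computable1 h \<and>
        (\<forall>m. \<exists>t0. \<forall>t\<ge>t0. g m t = f m) \<and>
        (\<forall>m. finite {t. g m (Suc t) \<noteq> g m t} \<and> card {t. g m (Suc t) \<noteq> g m t} \<le> h m) \<and>
        (\<forall>m. S m = cyl (W (f m))) \<and>
        (\<forall>m. emeasure lam (S m) \<le> ennreal ((1/2) ^ m)))"

definition weakly_demuth_random :: "(nat \<Rightarrow> bool) \<Rightarrow> bool" where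
  "weakly_demuth_random Z \<longleftrightarrow> (\<forall>S. demuth_test S \<longrightarrow> (\<exists>m. Z \<notin> S m))"

end

theory Submission
  imports Defs
begin

text \<open>Suppose the weakly Demuth random reals were \<open>\<Union>i. G i\<close> with \<open>G i = (\<Inter>j. F i j)\<close> and all \<open>F i j\<close> open.
  Force with effectively closed sets of positive measure: a generic real is weakly Demuth random, so
  some condition \<open>Q\<close> decides that it lies in some \<open>G i\<close>, that is, every \<open>F i j\<close> has positive measure in every
  condition below \<open>Q\<close>. On the other hand there is a Demuth test \<open>S\<close> each of whose components has positive
  measure in every portion of \<open>Q\<close> of positive measure. Alternating between the \<open>F i n\<close> and the \<open>S n\<close> gives a real that
  lies in \<open>G i\<close> and fails the test.

  For the test, \<open>S m\<close> enumerates, for each string length \<open>L\<close>, short cylinders inside the current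
  approximation of \<open>Q\<close>, moving to another one whenever the present one has lost too much of its
  measure. Measure wasted in this way is bounded by the measure that leaves \<open>Q\<close> during the enumeration,
  so it suffices to start afresh each time the measure removed from \<open>Q\<close> passes another multiple of
  \<open>2 ^ -(m + 1)\<close>; this happens at most \<open>2 ^ (m + 1)\<close> times.\<close>

subsection \<open>Closure properties of recursive functions\<close>

text \<open>By induction on the first derivation, inverting the second. For \<open>Minim\<close>,
  the smaller of two distinct results would be an argument where the searched function is both zero
  and positive.\<close>

lemma eval_deterministic: "eval c xs y \<Longrightarrow> eval c xs z \<Longrightarrow> y = z"
proof (induction arbitrary: z rule: eval.induct)
  case (comp xs gs ys f z')
  from comp.prems obtain ys' where ys': "list_all2 (\<lambda>g y. eval g xs y) gs ys'" "eval f ys' z"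
    by (cases rule: eval.cases) auto
  have "ys = ys'"
  proof (rule nth_equalityI)
    show "length ys = length ys'"
      by (rule trans[OF sym[OF list_all2_lengthD[OF comp.IH(1)]] list_all2_lengthD[OF ys'(1)]])
    show "ys ! i = ys' ! i" if "i < length ys" for i
      using comp.IH(1) ys'(1) that by (auto simp: list_all2_conv_all_nth)
  qed
  with ys' comp.IH show ?case by blast
next
  case (prS f g n xs y z')
  from prS.prems obtain y' where "eval (PrimRec f g) (n # xs) y'" "eval g (y' # n # xs) z"
    by (cases rule: eval.cases) auto
  with prS.IH show ?case by blast
next
  case (minim f n xs)
  from minim.prems have z: "eval f (z # xs) 0" "\<forall>k<z. \<exists>y. eval f (k # xs) y \<and> y > 0"
    by (cases rule: eval.cases; auto)+
  show ?case
  proof (rule linorder_cases[of n z])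
    assume "n < z"
    then obtain y where "eval f (n # xs) y" "y > 0" using z by blast
    then show ?thesis using minim.IH(1) by fastforce
  next
    assume "z < n"
    then show ?thesis using minim.IH(2) z(1) by fastforce
  qed
next
  case (zero xs)
  then show ?case by (cases rule: eval.cases) auto
next
  case (succ x xs)
  then show ?case by (cases rule: eval.cases) auto
next
  case (proj i xs)
  from proj.prems show ?case by (cases rule: eval.cases) auto
next
  case (pr0 f xs y g)
  from pr0.prems have "eval f xs z" by (cases rule: eval.cases) auto
  with pr0.IH show ?case by blast
qed

text \<open>Arguments are passed as an environment \<open>e\<close> of which only the first \<open>n\<close> entries matter,
  so that projections need no length conditions and binders shift the environment.\<close>

definition recursive :: "nat \<Rightarrow> ((nat \<Rightarrow> nat) \<Rightarrow> nat) \<Rightarrow> bool" where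
  "recursive n F \<longleftrightarrow> (\<exists>c. \<forall>e. eval c (map e [0..<n]) (F e))"

definition decidable :: "nat \<Rightarrow> ((nat \<Rightarrow> nat) \<Rightarrow> bool) \<Rightarrow> bool" where
  "decidable n P \<longleftrightarrow> recursive n (\<lambda>e. of_bool (P e))"

text \<open>The program is run on the first \<open>n\<close> entries only, so determinism forces
  equal values.\<close>

lemma recursive_cong_env:
  assumes "recursive n F" "\<And>i. i < n \<Longrightarrow> d i = e i"
  shows "F d = F e"
proof -
  obtain c where c: "\<And>e. eval c (map e [0..<n]) (F e)"
    using assms(1) by (auto simp: recursive_def)
  have "map d [0..<n] = map e [0..<n]" using assms(2) by auto
  with c[of d] c[of e] show ?thesis by (metis eval_deterministic)
qed

lemma recursive_proj [intro]: "i < n \<Longrightarrow> recursive n (\<lambda>e. e i)"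
  unfolding recursive_def
  by (rule exI[of _ "Proj i"]) (use eval.proj[of i "map _ [0..<n]"] in \<open>simp\<close>)

lemma recursive_comp:
  assumes "recursive l F" "\<And>i. i < l \<Longrightarrow> recursive n (G i)"
  shows "recursive n (\<lambda>e. F (\<lambda>i. G i e))"
proof -
  obtain f where f: "\<And>e. eval f (map e [0..<l]) (F e)"
    using assms(1) by (auto simp: recursive_def)
  have "\<exists>g. \<forall>i<l. \<forall>e. eval (g i) (map e [0..<n]) (G i e)"
    using assms(2) unfolding recursive_def by metis
  then obtain g where g: "\<And>i e. i < l \<Longrightarrow> eval (g i) (map e [0..<n]) (G i e)" by blast
  have "eval (Comp f (map g [0..<l])) (map e [0..<n]) (F (\<lambda>i. G i e))" for e
    by (rule eval.comp[OF _ f]) (auto simp: list_all2_conv_all_nth g)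
  then show ?thesis unfolding recursive_def by blast
qed

lemma recursive_Suc:
  assumes "recursive n A"
  shows "recursive n (\<lambda>e. Suc (A e))"
proof -
  have "recursive 1 (\<lambda>e. Suc (e 0))"
    unfolding recursive_def by (rule exI[of _ Succ]) (auto intro: eval.succ)
  from recursive_comp[OF this, of n "\<lambda>_. A"] assms show ?thesis by simp
qed

lemma recursive_const: "recursive n (\<lambda>_. k)"
proof (induction k)
  case 0
  show ?case unfolding recursive_def by (rule exI[of _ Zero]) (auto intro: eval.zero)
qed (rule recursive_Suc)

text \<open>Following the argument order of \<open>prS\<close>, the step function finds the
  accumulator in entry 0 and the counter in entry 1 of its environment.\<close>

lemma recursive_rec:
  assumes A: "recursive n A"
    and G: "recursive (Suc (Suc n)) (\<lambda>e. G (e (Suc 0)) (e 0) (\<lambda>i. e (Suc (Suc i))))"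
    and B: "recursive n B"
  shows "recursive n (\<lambda>e. rec_nat (A e) (\<lambda>k acc. G k acc e) (B e))"
proof -
  obtain f where f: "\<And>e. eval f (map e [0..<n]) (A e)"
    using A by (auto simp: recursive_def)
  obtain g where g: "\<And>e. eval g (map e [0..<Suc (Suc n)]) (G (e (Suc 0)) (e 0) (\<lambda>i. e (Suc (Suc i))))"
    using G by (auto simp: recursive_def)
  have g': "eval g (a # k # map e [0..<n]) (G k a e)" for a k e
    using g[of "case_nat a (case_nat k e)"] by (simp add: map_upt_Suc del: upt_Suc)
  have "eval (PrimRec f g) (k # map e [0..<n]) (rec_nat (A e) (\<lambda>k acc. G k acc e) k)" for k e
    by (induction k) (auto intro: eval.pr0 eval.prS f g')
  then have rec: "recursive (Suc n) (\<lambda>e. rec_nat (A (\<lambda>i. e (Suc i))) (\<lambda>k acc. G k acc (\<lambda>i. e (Suc i))) (e 0))"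
    unfolding recursive_def
    by (intro exI[of _ "PrimRec f g"])
      (simp add: map_upt_Suc del: upt_Suc)
  \<comment> \<open>The recursion argument occupies entry 0 of the longer environment; substituting
    \<open>B\<close> there and projections elsewhere eliminates it.\<close>
  have "recursive n (case_nat B (\<lambda>i e. e i) i)" if "i < Suc n" for i
    using B that by (cases i) auto
  from recursive_comp[OF rec, of n "case_nat B (\<lambda>i e. e i)", OF this] show ?thesis by simp
qed

section \<open>Arithmetic operations\<close>

lemma recursive_add:
  assumes "recursive n A" "recursive n B"
  shows "recursive n (\<lambda>e. A e + B e)"
proof -
  have "recursive n (\<lambda>e. rec_nat (A e) (\<lambda>k acc. Suc acc) (B e))"
    by (intro recursive_rec recursive_Suc recursive_proj assms) auto
  moreover have "rec_nat a (\<lambda>k acc. Suc acc) b = a + b" for a b :: nat by (induction b) auto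
  ultimately show ?thesis by simp
qed

lemma recursive_pred:
  assumes "recursive n A"
  shows "recursive n (\<lambda>e. A e - 1)"
proof -
  have "recursive n (\<lambda>e. rec_nat 0 (\<lambda>k acc. k) (A e))"
    by (intro recursive_rec recursive_const recursive_proj assms) auto
  moreover have "rec_nat 0 (\<lambda>k acc. k) a = a - 1" for a :: nat by (cases a) auto
  ultimately show ?thesis by simp
qed

lemma recursive_diff:
  assumes "recursive n A" "recursive n B"
  shows "recursive n (\<lambda>e. A e - B e)"
proof -
  have "recursive n (\<lambda>e. rec_nat (A e) (\<lambda>k acc. acc - 1) (B e))"
    by (intro recursive_rec recursive_pred recursive_proj assms) auto
  moreover have "rec_nat a (\<lambda>k acc. acc - 1) b = a - b" for a b :: nat by (induction b) auto
  ultimately show ?thesis by simp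
qed

lemma recursive_sum:
  assumes "recursive n B" "recursive (Suc n) (\<lambda>e. F (e 0) (\<lambda>i. e (Suc i)))"
  shows "recursive n (\<lambda>e. \<Sum>k<B e. F k e)"
proof -
  have "recursive (Suc (Suc n)) (\<lambda>e. F (e (Suc 0)) (\<lambda>i. e (Suc (Suc i))))"
    using recursive_comp[OF assms(2), of "Suc (Suc n)" "\<lambda>i e. e (Suc i)"] by auto
  then have "recursive n (\<lambda>e. rec_nat 0 (\<lambda>k acc. acc + F k e) (B e))"
    by (intro recursive_rec recursive_const recursive_add recursive_proj assms) auto
  moreover have "rec_nat 0 (\<lambda>k acc. acc + F k e) b = (\<Sum>k<b. F k e)" for b e
    by (induction b) auto
  ultimately show ?thesis by simp
qed

lemma recursive_mult:
  assumes "recursive n A" "recursive n B"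
  shows "recursive n (\<lambda>e. A e * B e)"
proof -
  have "recursive (Suc n) (\<lambda>e. A (\<lambda>i. e (Suc i)))"
    using recursive_comp[OF assms(1), of "Suc n" "\<lambda>i e. e (Suc i)"] by auto
  then have "recursive n (\<lambda>e. \<Sum>k<B e. A e)"
    by (intro recursive_sum assms)
  then show ?thesis by (simp add: mult.commute)
qed

lemma recursive_power2:
  assumes "recursive n A"
  shows "recursive n (\<lambda>e. 2 ^ A e)"
proof -
  have "recursive n (\<lambda>e. rec_nat 1 (\<lambda>k acc. 2 * acc) (A e))"
    by (intro recursive_rec recursive_const recursive_mult recursive_proj assms) auto
  moreover have "rec_nat 1 (\<lambda>k acc. 2 * acc) b = (2 ^ b :: nat)" for b by (induction b) auto
  ultimately show ?thesis by simp
qed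

section \<open>Decidable predicates and bounded quantifiers\<close>

lemma decidable_le:
  assumes "recursive n A" "recursive n B"
  shows "decidable n (\<lambda>e. A e \<le> B e)"
proof -
  have "recursive n (\<lambda>e. 1 - (A e - B e))"
    by (intro recursive_diff recursive_const assms)
  moreover have "1 - (a - b) = of_bool (a \<le> b)" for a b :: nat by auto
  ultimately show ?thesis by (simp add: decidable_def)
qed

lemma decidable_not:
  assumes "decidable n P"
  shows "decidable n (\<lambda>e. \<not> P e)"
proof -
  have "recursive n (\<lambda>e. 1 - of_bool (P e))"
    using assms by (intro recursive_diff recursive_const) (simp add: decidable_def)
  moreover have "1 - of_bool p = (of_bool (\<not> p) :: nat)" for p by auto
  ultimately show ?thesis by (simp add: decidable_def)
qed

lemma decidable_conj:
  assumes "decidable n P" "decidable n Q"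
  shows "decidable n (\<lambda>e. P e \<and> Q e)"
  using recursive_mult[OF assms[unfolded decidable_def]]
  by (simp add: decidable_def of_bool_conj)

lemma decidable_disj:
  assumes "decidable n P" "decidable n Q"
  shows "decidable n (\<lambda>e. P e \<or> Q e)"
  using decidable_not[OF decidable_conj[OF decidable_not[OF assms(1)] decidable_not[OF assms(2)]]]
  by simp

lemma decidable_imp:
  assumes "decidable n P" "decidable n Q"
  shows "decidable n (\<lambda>e. P e \<longrightarrow> Q e)"
  using decidable_disj[OF decidable_not[OF assms(1)] assms(2)] by simp

lemma decidable_less:
  assumes "recursive n A" "recursive n B"
  shows "decidable n (\<lambda>e. A e < B e)"
  using decidable_not[OF decidable_le[OF assms(2,1)]] by (simp add: not_le)

lemma decidable_eq:
  assumes "recursive n A" "recursive n B"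
  shows "decidable n (\<lambda>e. A e = B e)"
  using decidable_conj[OF decidable_le[OF assms] decidable_le[OF assms(2,1)]]
  by (simp add: eq_iff)

lemma recursive_if:
  assumes "decidable n P" "recursive n A" "recursive n B"
  shows "recursive n (\<lambda>e. if P e then A e else B e)"
proof -
  have "recursive n (\<lambda>e. of_bool (P e) * A e + of_bool (\<not> P e) * B e)"
    using assms decidable_not[OF assms(1)]
    by (intro recursive_add recursive_mult) (auto simp: decidable_def)
  moreover have "of_bool p * a + of_bool (\<not> p) * b = (if p then a else b)" for p and a b :: nat
    by auto
  ultimately show ?thesis by simp
qed

lemma decidable_bex:
  assumes "recursive n B" "decidable (Suc n) (\<lambda>e. P (e 0) (\<lambda>i. e (Suc i)))"
  shows "decidable n (\<lambda>e. \<exists>k<B e. P k e)"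
proof -
  have "recursive n (\<lambda>e. \<Sum>k<B e. of_bool (P k e))"
    using assms by (intro recursive_sum) (simp_all add: decidable_def)
  then have "decidable n (\<lambda>e. 0 < (\<Sum>k<B e. (of_bool (P k e) :: nat)))"
    by (intro decidable_less recursive_const)
  moreover have "0 < (\<Sum>k<b. (of_bool (P k e) :: nat)) \<longleftrightarrow> (\<exists>k<b. P k e)" for b e
    by (induction b) (auto simp: less_Suc_eq)
  ultimately show ?thesis by simp
qed

lemma decidable_ball:
  assumes "recursive n B" "decidable (Suc n) (\<lambda>e. P (e 0) (\<lambda>i. e (Suc i)))"
  shows "decidable n (\<lambda>e. \<forall>k<B e. P k e)"
  using decidable_not[OF decidable_bex[OF assms(1) decidable_not[OF assms(2)]]] by simp

text \<open>Here \<open>l\<close> is a fixed number and each \<open>P i\<close> may have its own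
  decision procedure, without uniformity in \<open>i\<close>. This is the situation for the argument
  list of a \<open>Comp\<close>.\<close>

lemma decidable_ball_fixed:
  fixes l :: nat
  assumes "\<And>i. i < l \<Longrightarrow> decidable n (P i)"
  shows "decidable n (\<lambda>e. \<forall>i<l. P i e)"
  using assms
proof (induction l)
  case 0
  show ?case by (simp add: decidable_def recursive_const)
next
  case (Suc l)
  then have "decidable n (\<lambda>e. (\<forall>i<l. P i e) \<and> P l e)" by (intro decidable_conj) auto
  moreover have "(\<forall>i<Suc l. P i e) \<longleftrightarrow> (\<forall>i<l. P i e) \<and> P l e" for e
    by (auto simp: less_Suc_eq)
  ultimately show ?case by simp
qed

lemma recursive_count:
  assumes "recursive n B" "decidable (Suc n) (\<lambda>e. P (e 0) (\<lambda>i. e (Suc i)))"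
  shows "recursive n (\<lambda>e. card {k. k < B e \<and> P k e})"
proof -
  have "recursive n (\<lambda>e. \<Sum>k<B e. of_bool (P k e))"
    using assms by (intro recursive_sum) (simp_all add: decidable_def)
  moreover have "(\<Sum>k<b. of_bool (P k e)) = card {k. k < b \<and> P k e}" for b e
    by (simp add: of_bool_def sum.If_cases Int_def lessThan_def)
  ultimately show ?thesis by simp
qed

text \<open>The quotient counts the positive multiples of the divisor up to the dividend. Divisor 0
  is treated apart, since that count would then return the dividend instead of 0.\<close>

lemma recursive_div:
  assumes "recursive n A" "recursive n B"
  shows "recursive n (\<lambda>e. A e div B e)"
proof -
  have shift: "recursive (Suc n) (\<lambda>e. X (\<lambda>i. e (Suc i)))" if "recursive n X" for X
    using recursive_comp[OF that, of "Suc n" "\<lambda>i e. e (Suc i)"] by auto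
  have "recursive n (\<lambda>e. if B e = 0 then 0 else card {k. k < A e \<and> Suc k * B e \<le> A e})"
    by (intro recursive_if recursive_const decidable_eq recursive_count decidable_le
        recursive_mult recursive_Suc recursive_proj assms shift) auto
  moreover have "(if b = 0 then 0 else card {k. k < a \<and> Suc k * b \<le> a}) = a div b" for a b :: nat
  proof (cases "b = 0")
    case False
    then have *: "Suc k * b \<le> a \<longleftrightarrow> k < a div b" for k
      by (simp add: less_eq_div_iff_mult_less_eq Suc_le_eq[symmetric] del: mult_Suc)
    have "{k. k < a \<and> Suc k * b \<le> a} = {..<a div b}"
      unfolding * by (auto dest: less_le_trans[OF _ div_le_dividend])
    with False show ?thesis by (simp del: mult_Suc)
  qed simp
  ultimately show ?thesis by simp
qed

lemma recursive_mod:
  assumes "recursive n A" "recursive n B"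
  shows "recursive n (\<lambda>e. A e mod B e)"
  unfolding modulo_nat_def by (intro recursive_diff recursive_mult recursive_div assms)

lemmas recursive_intros = recursive_Suc recursive_const recursive_add recursive_diff recursive_sum recursive_mult
  recursive_power2 decidable_le decidable_not decidable_conj decidable_disj decidable_imp decidable_less
  decidable_eq recursive_if decidable_bex decidable_ball recursive_count recursive_div recursive_mod

subsection \<open>Stage approximations of partial recursive functions\<close>

inductive_cases eval_ZeroE: "eval Zero xs y"
inductive_cases eval_SuccE: "eval Succ xs y"
inductive_cases eval_ProjE: "eval (Proj i) xs y"
inductive_cases eval_CompE: "eval (Comp f gs) xs y"
inductive_cases eval_PrimRec_NilE: "eval (PrimRec f g) [] y"
inductive_cases eval_PrimRec_0E: "eval (PrimRec f g) (0 # xs) y"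
inductive_cases eval_PrimRec_SucE: "eval (PrimRec f g) (Suc n # xs) y"
inductive_cases eval_MinimE: "eval (Minim f) xs y"

text \<open>\<open>F s\<close> simulates \<open>c\<close> with all searches bounded by \<open>s\<close>; it returns the successor of the value,
  and \<open>0\<close> if the simulation has not halted.\<close>

definition stage_evaluation :: "nat \<Rightarrow> recf \<Rightarrow> (nat \<Rightarrow> (nat \<Rightarrow> nat) \<Rightarrow> nat) \<Rightarrow> bool" where
  "stage_evaluation n c F \<longleftrightarrow>
     recursive (Suc n) (\<lambda>e. F (e 0) (\<lambda>i. e (Suc i))) \<and>
     (\<forall>s t e y. s \<le> t \<longrightarrow> F s e = Suc y \<longrightarrow> F t e = Suc y) \<and>
     (\<forall>e y. eval c (map e [0..<n]) y \<longleftrightarrow> (\<exists>s. F s e = Suc y))"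

lemma stage_evaluation_mono: "stage_evaluation n c F \<Longrightarrow> F s e = Suc y \<Longrightarrow> s \<le> t \<Longrightarrow> F t e = Suc y"
  unfolding stage_evaluation_def by blast

lemma stage_evaluation_iff: "stage_evaluation n c F \<Longrightarrow> eval c (map e [0..<n]) y \<longleftrightarrow> (\<exists>s. F s e = Suc y)"
  unfolding stage_evaluation_def by blast

lemma stage_evaluation_recursive:
  assumes "stage_evaluation n c F" "recursive m S" "\<And>i. i < n \<Longrightarrow> recursive m (E i)"
  shows "recursive m (\<lambda>e. F (S e) (\<lambda>i. E i e))"
proof -
  have F: "recursive (Suc n) (\<lambda>e. F (e 0) (\<lambda>i. e (Suc i)))"
    using assms(1) by (simp add: stage_evaluation_def)
  have "recursive m (case_nat S E i)" if "i < Suc n" for i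
    using assms(2,3) that by (cases i) auto
  from recursive_comp[OF F, of m "case_nat S E", OF this] show ?thesis by simp
qed

text \<open>Handles environments extended at the front by \<open>case_nat\<close>, read at a fixed
  position.\<close>

lemma recursive_case_nat:
  assumes "recursive n A" "\<And>j. i = Suc j \<Longrightarrow> recursive n (B j)"
  shows "recursive n (\<lambda>e. case i of 0 \<Rightarrow> A e | Suc j \<Rightarrow> B j e)"
  using assms by (cases i) auto

lemma stage_evaluation_cong:
  assumes F: "stage_evaluation n c F" and "\<And>i. i < n \<Longrightarrow> d i = e i"
  shows "F s d = F s e"
proof -
  have "recursive n (\<lambda>e. F s (\<lambda>i. e i))"
    by (intro stage_evaluation_recursive[OF F] recursive_const recursive_proj)
  from recursive_cong_env[OF this assms(2)] show ?thesis by simp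
qed

text \<open>The sum of finitely many stages bounds each of them, and monotonicity carries every
  property up to it.\<close>

lemma uniform_stage:
  fixes P :: "nat \<Rightarrow> nat \<Rightarrow> bool"
  assumes "\<And>j. j < n \<Longrightarrow> \<exists>s. P j s" "\<And>j s t. j < n \<Longrightarrow> P j s \<Longrightarrow> s \<le> t \<Longrightarrow> P j t"
  shows "\<exists>s. \<forall>j<n. P j s"
proof -
  from assms(1) obtain f where f: "\<And>j. j < n \<Longrightarrow> P j (f j)" by metis
  have "P j (\<Sum>j<n. f j)" if "j < n" for j
    using assms(2)[OF that f[OF that]] that by (simp add: member_le_sum)
  then show ?thesis by blast
qed

text \<open>A bounded search written as a sum: at most one summand is nonzero, and it is the
  successor of the point found.\<close>

lemma sum_unique_eq_Suc_iff:
  fixes Q :: "nat \<Rightarrow> bool"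
  assumes "\<And>j k. Q j \<Longrightarrow> Q k \<Longrightarrow> j = k"
  shows "(\<Sum>k<s. if Q k then Suc k else 0) = Suc y \<longleftrightarrow> y < s \<and> Q y"
proof (cases "\<exists>k<s. Q k")
  case True
  then obtain k where k: "k < s" "Q k" by blast
  have "(\<Sum>i<s. if Q i then Suc i else 0) = (\<Sum>i<s. if i = k then Suc k else 0)"
    using assms k(2) by (intro sum.cong) auto
  also have "\<dots> = Suc k" using k(1) by simp
  finally show ?thesis using assms k by auto
next
  case False
  then have "(\<Sum>i<s. if Q i then Suc i else 0) = 0" by simp
  with False show ?thesis by auto
qed

section \<open>Simulation of each program constructor\<close>

lemma stage_evaluation_Zero: "stage_evaluation n Zero (\<lambda>s e. 1)"
  unfolding stage_evaluation_def
  by (auto intro: eval.zero recursive_const elim: eval_ZeroE)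

lemma stage_evaluation_Succ: "stage_evaluation n Succ (\<lambda>s e. if n = 0 then 0 else Suc (Suc (e 0)))"
proof (cases n)
  case 0
  then show ?thesis
    unfolding stage_evaluation_def by (auto intro: recursive_const elim: eval_SuccE)
next
  case (Suc m)
  have "eval Succ (e 0 # xs) y \<longleftrightarrow> y = Suc (e 0)" for xs y and e :: "nat \<Rightarrow> nat"
    by (auto intro: eval.succ elim: eval_SuccE)
  with Suc show ?thesis
    unfolding stage_evaluation_def
    by (auto simp: map_upt_Suc simp del: upt_Suc intro!: recursive_Suc recursive_proj)
qed

lemma stage_evaluation_Proj: "stage_evaluation n (Proj j) (\<lambda>s e. if j < n then Suc (e j) else 0)"
proof -
  have "eval (Proj j) (map e [0..<n]) y \<longleftrightarrow> j < n \<and> y = e j" for e y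
  proof
    assume "j < n \<and> y = e j"
    then show "eval (Proj j) (map e [0..<n]) y"
      using eval.proj[of j "map e [0..<n]"] by simp
  qed (auto elim: eval_ProjE)
  then show ?thesis
    unfolding stage_evaluation_def
    by (cases "j < n") (auto intro: recursive_Suc recursive_proj recursive_const)
qed

text \<open>The guard waits until all inner simulations have halted, after which \<open>- 1\<close>
  recovers their values. Values no longer change once found, so one stage serves all inner programs
  and the outer one.\<close>

lemma stage_evaluation_Comp:
  assumes f: "stage_evaluation (length gs) f F"
    and g: "\<And>i. i < length gs \<Longrightarrow> stage_evaluation n (gs ! i) (G i)"
  shows "stage_evaluation n (Comp f gs)
    (\<lambda>s e. if \<forall>i<length gs. 0 < G i s e then F s (\<lambda>i. G i s e - 1) else 0)" (is "stage_evaluation _ _ ?H")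
proof -
  have rec: "recursive (Suc n) (\<lambda>e. ?H (e 0) (\<lambda>i. e (Suc i)))"
    by (intro recursive_if decidable_ball_fixed decidable_less recursive_const
        stage_evaluation_recursive[OF f] stage_evaluation_recursive[OF g] recursive_diff recursive_proj) auto
  have G_mono: "G i t e = G i s e" if "i < length gs" "s \<le> t" "0 < G i s e" for i s t e
    using stage_evaluation_mono[OF g[OF that(1)], of s e "G i s e - 1" t] that by simp
  have F_cong: "F s d = F s e" if "\<And>i. i < length gs \<Longrightarrow> d i = e i" for s d e
    by (rule stage_evaluation_cong[OF f that])
  have mono: "\<forall>s t e y. s \<le> t \<longrightarrow> ?H s e = Suc y \<longrightarrow> ?H t e = Suc y"
  proof (intro allI impI)
    fix s t e y assume "s \<le> t" and H: "?H s e = Suc y"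
    from H have pos: "\<And>i. i < length gs \<Longrightarrow> 0 < G i s e" and y: "F s (\<lambda>i. G i s e - 1) = Suc y"
      by (auto split: if_splits)
    have G: "\<And>i. i < length gs \<Longrightarrow> G i t e = G i s e" using G_mono pos \<open>s \<le> t\<close> by blast
    have "F t (\<lambda>i. G i t e - 1) = F t (\<lambda>i. G i s e - 1)" by (rule F_cong) (simp add: G)
    with stage_evaluation_mono[OF f, OF y \<open>s \<le> t\<close>] G pos show "?H t e = Suc y" by simp
  qed
  have iff: "\<forall>e y. eval (Comp f gs) (map e [0..<n]) y \<longleftrightarrow> (\<exists>s. ?H s e = Suc y)"
  proof (intro allI iffI)
    fix e y
    assume "eval (Comp f gs) (map e [0..<n]) y"
    then obtain ys where ys: "list_all2 (\<lambda>g y. eval g (map e [0..<n]) y) gs ys" "eval f ys y"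
      by (blast elim: eval_CompE)
    then have len: "length ys = length gs" by (auto dest: list_all2_lengthD)
    have "\<exists>s. G i s e = Suc (ys ! i)" if "i < length gs" for i
      using ys(1) that stage_evaluation_iff[OF g[OF that]] by (auto simp: list_all2_conv_all_nth)
    then have "\<exists>s. \<forall>i<length gs. G i s e = Suc (ys ! i)"
      by (rule uniform_stage) (auto intro: stage_evaluation_mono[OF g])
    then obtain s where s: "\<And>i. i < length gs \<Longrightarrow> G i s e = Suc (ys ! i)" by blast
    have "map (\<lambda>i. ys ! i) [0..<length gs] = ys" using len by (metis map_nth)
    with ys(2) stage_evaluation_iff[OF f, of "\<lambda>i. ys ! i"] obtain t where t: "F t (\<lambda>i. ys ! i) = Suc y"
      by auto
    define u where "u = max s t"
    have u: "G i u e = Suc (ys ! i)" if "i < length gs" for i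
      using stage_evaluation_mono[OF g[OF that], OF s[OF that]] by (simp add: u_def)
    have "F u (\<lambda>i. G i u e - 1) = F u (\<lambda>i. ys ! i)" by (rule F_cong) (simp add: u)
    also have "\<dots> = Suc y" using stage_evaluation_mono[OF f, OF t] by (simp add: u_def)
    finally show "\<exists>s. ?H s e = Suc y" using u by (intro exI[of _ u]) auto
  next
    fix e y
    assume "\<exists>s. ?H s e = Suc y"
    then obtain s where s: "\<And>i. i < length gs \<Longrightarrow> 0 < G i s e" "F s (\<lambda>i. G i s e - 1) = Suc y"
      by (auto split: if_splits)
    have "eval f (map (\<lambda>i. G i s e - 1) [0..<length gs]) y"
      using stage_evaluation_iff[OF f] s(2) by blast
    moreover have "eval (gs ! i) (map e [0..<n]) (G i s e - 1)" if "i < length gs" for i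
      using stage_evaluation_iff[OF g[OF that]] s(1)[OF that] by (metis Suc_diff_1)
    ultimately show "eval (Comp f gs) (map e [0..<n]) y"
      by (intro eval.comp) (auto simp: list_all2_conv_all_nth)
  qed
  show ?thesis
    unfolding stage_evaluation_def by (intro conjI rec mono iff)
qed

lemma map_case_nat_upt: "map (case_nat k e) [0..<Suc n] = k # map e [0..<n]"
  by (simp add: map_upt_Suc del: upt_Suc)

text \<open>An accumulator 0 means that an earlier round has not halted; it is passed on unchanged
  to the end.\<close>

lemma stage_evaluation_PrimRec:
  assumes f: "stage_evaluation n f F" and g: "stage_evaluation (Suc (Suc n)) g G"
  shows "stage_evaluation (Suc n) (PrimRec f g)
    (\<lambda>s e. rec_nat (F s (\<lambda>i. e (Suc i)))
      (\<lambda>k acc. if acc = 0 then 0 else G s (case_nat (acc - 1) (case_nat k (\<lambda>i. e (Suc i))))) (e 0))"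
    (is "stage_evaluation _ _ (\<lambda>s e. ?H s e (e 0))")
proof -
  have rec: "recursive (Suc (Suc n)) (\<lambda>e. ?H (e 0) (\<lambda>i. e (Suc i)) (e (Suc 0)))"
    by (intro recursive_rec recursive_if decidable_eq recursive_const
        stage_evaluation_recursive[OF f] stage_evaluation_recursive[OF g] recursive_diff recursive_proj
        recursive_case_nat) auto
  have mono: "?H s e k = Suc y \<Longrightarrow> s \<le> t \<Longrightarrow> ?H t e k = Suc y" for s t e k y
  proof (induction k arbitrary: y)
    case 0
    then show ?case using stage_evaluation_mono[OF f, of s _ y t] by simp
  next
    case (Suc k)
    then obtain z where z: "?H s e k = Suc z" by (auto split: if_splits simp: gr0_conv_Suc)
    with Suc.prems Suc.IH[OF z] show ?case using stage_evaluation_mono[OF g, of s _ y t] by simp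
  qed
  have mono': "\<forall>s t e y. s \<le> t \<longrightarrow> ?H s e (e 0) = Suc y \<longrightarrow> ?H t e (e 0) = Suc y"
  proof (intro allI impI)
    fix s t e y assume "s \<le> t" "?H s e (e 0) = Suc y"
    then show "?H t e (e 0) = Suc y" using mono[of s e "e 0" y t] by simp
  qed
  have iff: "eval (PrimRec f g) (k # map (\<lambda>i. e (Suc i)) [0..<n]) y \<longleftrightarrow> (\<exists>s. ?H s e k = Suc y)" for e k y
  proof (induction k arbitrary: y)
    case 0
    have "eval (PrimRec f g) (0 # map (\<lambda>i. e (Suc i)) [0..<n]) y \<longleftrightarrow> eval f (map (\<lambda>i. e (Suc i)) [0..<n]) y"
      by (blast intro: eval.pr0 elim: eval_PrimRec_0E)
    then show ?case using stage_evaluation_iff[OF f] by simp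
  next
    case (Suc k)
    have "eval (PrimRec f g) (Suc k # map (\<lambda>i. e (Suc i)) [0..<n]) y \<longleftrightarrow>
      (\<exists>z. eval (PrimRec f g) (k # map (\<lambda>i. e (Suc i)) [0..<n]) z \<and>
        eval g (z # k # map (\<lambda>i. e (Suc i)) [0..<n]) y)"
      by (blast intro: eval.prS elim: eval_PrimRec_SucE)
    also have "\<dots> \<longleftrightarrow> (\<exists>z. (\<exists>s. ?H s e k = Suc z) \<and> (\<exists>s. G s (case_nat z (case_nat k (\<lambda>i. e (Suc i)))) = Suc y))"
      unfolding Suc.IH stage_evaluation_iff[OF g, symmetric] map_case_nat_upt ..
    also have "\<dots> \<longleftrightarrow> (\<exists>s. ?H s e (Suc k) = Suc y)"
    proof safe
      fix z s t assume "?H s e k = Suc z" "G t (case_nat z (case_nat k (\<lambda>i. e (Suc i)))) = Suc y"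
      then have "?H (max s t) e k = Suc z" "G (max s t) (case_nat z (case_nat k (\<lambda>i. e (Suc i)))) = Suc y"
        using mono[of s e k z "max s t"] stage_evaluation_mono[OF g, of t _ y "max s t"] by simp_all
      then show "\<exists>s. ?H s e (Suc k) = Suc y" by (intro exI[of _ "max s t"]) simp
    next
      fix s assume H: "?H s e (Suc k) = Suc y"
      then obtain z where "?H s e k = Suc z" by (auto split: if_splits simp: gr0_conv_Suc)
      with H show "\<exists>z. (\<exists>s. ?H s e k = Suc z) \<and> (\<exists>s. G s (case_nat z (case_nat k (\<lambda>i. e (Suc i)))) = Suc y)"
        by auto
    qed
    finally show ?case .
  qed
  have "eval (PrimRec f g) (map e [0..<Suc n]) y \<longleftrightarrow> (\<exists>s. ?H s e (e 0) = Suc y)" for e y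
    using iff[of "e 0" e y] by (simp add: map_upt_Suc del: upt_Suc)
  then have iff': "\<forall>e y. eval (PrimRec f g) (map e [0..<Suc n]) y \<longleftrightarrow> (\<exists>s. ?H s e (e 0) = Suc y)"
    by (intro allI)
  show ?thesis
    unfolding stage_evaluation_def by (intro conjI rec mono' iff')
qed

text \<open>Because of the successor coding, simulated value 1 means that \<open>f\<close> returned
  0, and a value of at least 2 means that it returned something positive. Only one \<open>k\<close>
  can satisfy both conditions of the search.\<close>

lemma stage_evaluation_Minim:
  assumes f: "stage_evaluation (Suc n) f F"
  shows "stage_evaluation n (Minim f)
    (\<lambda>s e. \<Sum>k<s. if F s (case_nat k e) = 1 \<and> (\<forall>j<k. 2 \<le> F s (case_nat j e)) then Suc k else 0)"
    (is "stage_evaluation _ _ (\<lambda>s e. \<Sum>k<s. if ?Q s e k then Suc k else 0)")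
proof -
  have unique: "j = k" if "?Q s e j" "?Q s e k" for s e j k
    using that by (cases j k rule: linorder_cases) fastforce+
  have sum_iff: "(\<Sum>k<s. if ?Q s e k then Suc k else 0) = Suc y \<longleftrightarrow> y < s \<and> ?Q s e y" for s e y
    by (rule sum_unique_eq_Suc_iff) (rule unique)
  have mono1: "F t e = 1" if "F s e = 1" "s \<le> t" for s t e
    using stage_evaluation_mono[OF f, of s e 0 t] that by simp
  have mono2: "2 \<le> F t e" if "2 \<le> F s e" "s \<le> t" for s t e
    using stage_evaluation_mono[OF f, of s e "F s e - 1" t] that by simp
  have rec: "recursive (Suc n) (\<lambda>e. \<Sum>k<e 0. if ?Q (e 0) (\<lambda>i. e (Suc i)) k then Suc k else 0)"
    by (intro recursive_intros stage_evaluation_recursive[OF f] recursive_proj recursive_case_nat) auto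
  have mono: "\<forall>s t e y. s \<le> t \<longrightarrow> y < s \<and> ?Q s e y \<longrightarrow> y < t \<and> ?Q t e y"
  proof (intro allI impI)
    fix s t e y assume "s \<le> t" "y < s \<and> ?Q s e y"
    then show "y < t \<and> ?Q t e y" using mono1[of s "case_nat y e" t] mono2[of s _ t] by auto
  qed
  have iff: "\<forall>e y. eval (Minim f) (map e [0..<n]) y \<longleftrightarrow> (\<exists>s. y < s \<and> ?Q s e y)"
    proof (intro allI iffI)
      fix e y
      assume "eval (Minim f) (map e [0..<n]) y"
      then have y: "eval f (y # map e [0..<n]) 0" "\<forall>j<y. \<exists>z. eval f (j # map e [0..<n]) z \<and> z > 0"
        by (blast elim: eval_MinimE)+
      obtain s where s: "F s (case_nat y e) = 1"
        using y(1) stage_evaluation_iff[OF f, of "case_nat y e" 0] by (auto simp: map_case_nat_upt simp del: upt_Suc)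
      have "\<exists>s. 2 \<le> F s (case_nat j e)" if "j < y" for j
      proof -
        from y(2) that obtain z where z: "eval f (j # map e [0..<n]) z" "z > 0" by blast
        then obtain s where "F s (case_nat j e) = Suc z"
          using stage_evaluation_iff[OF f, of "case_nat j e" z] by (auto simp: map_case_nat_upt simp del: upt_Suc)
        with z(2) show ?thesis by (intro exI[of _ s]) simp
      qed
      then have "\<exists>s. \<forall>j<y. 2 \<le> F s (case_nat j e)" by (rule uniform_stage) (use mono2 in blast)+
      then obtain t where t: "\<forall>j<y. 2 \<le> F t (case_nat j e)" by blast
      \<comment> \<open>The stage has to exceed \<open>y\<close> as well, because it also bounds the
        range of the sum.\<close>
      show "\<exists>s. y < s \<and> ?Q s e y"
        using mono1[OF s, of "Suc y + s + t"] t mono2[of t _ "Suc y + s + t"]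
        by (intro exI[of _ "Suc y + s + t"]) auto
    next
      fix e y
      assume "\<exists>s. y < s \<and> ?Q s e y"
      then obtain s where s: "F s (case_nat y e) = 1" "\<forall>j<y. 2 \<le> F s (case_nat j e)" by blast
      show "eval (Minim f) (map e [0..<n]) y"
      proof (rule eval.minim)
        show "eval f (y # map e [0..<n]) 0"
          using s(1) stage_evaluation_iff[OF f, of "case_nat y e" 0] by (auto simp: map_case_nat_upt simp del: upt_Suc)
        show "\<forall>k<y. \<exists>z. eval f (k # map e [0..<n]) z \<and> z > 0"
        proof (intro allI impI)
          fix k assume "k < y"
          with s(2) have "2 \<le> F s (case_nat k e)" by blast
          then have "F s (case_nat k e) = Suc (F s (case_nat k e) - 1)" "0 < F s (case_nat k e) - 1" by auto
          then show "\<exists>z. eval f (k # map e [0..<n]) z \<and> z > 0"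
            using stage_evaluation_iff[OF f, of "case_nat k e"] unfolding map_case_nat_upt by blast
        qed
      qed
    qed
  show ?thesis
    unfolding stage_evaluation_def sum_iff by (intro conjI rec mono iff)
qed

lemma stage_evaluation_exists: "\<exists>F. stage_evaluation n c F"
proof (induction c arbitrary: n rule: recf.induct)
  case (Comp f gs)
  then obtain F where F: "stage_evaluation (length gs) f F" by blast
  have "\<forall>i. \<exists>G. i < length gs \<longrightarrow> stage_evaluation n (gs ! i) G"
    using Comp.IH(2) by (meson nth_mem)
  then obtain G where G: "\<And>i. i < length gs \<Longrightarrow> stage_evaluation n (gs ! i) (G i)" by metis
  show ?case by (rule exI, rule stage_evaluation_Comp[OF F], rule G)
next
  case (PrimRec f g)
  show ?case
  proof (cases n)
    \<comment> \<open>No rule evaluates \<open>PrimRec\<close> on the empty argument list, so the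
      simulation that never halts is correct.\<close>
    case 0
    have "\<not> eval (PrimRec f g) [] y" for y by (blast elim: eval_PrimRec_NilE)
    then have "stage_evaluation n (PrimRec f g) (\<lambda>s e. 0)"
      using 0 by (auto simp: stage_evaluation_def intro: recursive_const)
    then show ?thesis by blast
  next
    case (Suc m)
    obtain F G where FG: "stage_evaluation m f F" "stage_evaluation (Suc (Suc m)) g G"
      using PrimRec.IH by blast
    show ?thesis unfolding Suc by (rule exI, rule stage_evaluation_PrimRec, rule FG, rule FG)
  qed
next
  case (Minim f)
  then obtain F where F: "stage_evaluation (Suc n) f F" by blast
  show ?case by (rule exI, rule stage_evaluation_Minim, rule F)
qed (use stage_evaluation_Zero stage_evaluation_Succ stage_evaluation_Proj in blast)+

text \<open>Presents a c.e. set as an increasing union of decidable stages, the form needed to turn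
  \<open>W\<close> into an effectively open set.\<close>

lemma domain_stages:
  obtains T where "decidable 2 (\<lambda>e. T (e 0) (e 1))"
    "\<And>x s t. T x s \<Longrightarrow> s \<le> t \<Longrightarrow> T x t" "\<And>x. (\<exists>y. eval c [x] y) \<longleftrightarrow> (\<exists>s. T x s)"
proof -
  obtain F where F: "stage_evaluation 1 c F" using stage_evaluation_exists by blast
  define T where "T x s \<longleftrightarrow> 0 < F s (\<lambda>_. x)" for x s
  show ?thesis
  proof
    show "decidable 2 (\<lambda>e. T (e 0) (e 1))"
      unfolding T_def
      by (intro decidable_less recursive_const stage_evaluation_recursive[OF F] recursive_proj) auto
    show "T x t" if "T x s" "s \<le> t" for x s t
      using stage_evaluation_mono[OF F, of s "\<lambda>_. x" "F s (\<lambda>_. x) - 1" t] that by (simp add: T_def)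
    show "(\<exists>y. eval c [x] y) \<longleftrightarrow> (\<exists>s. T x s)" for x
      using stage_evaluation_iff[OF F, of "\<lambda>_. x"] by (auto simp: T_def gr0_conv_Suc)
  qed
qed

subsection \<open>Indices and effectively open sets\<close>

text \<open>Serves twice: \<open>W (enc c)\<close> is the domain of \<open>c\<close> itself, and
  there are only countably many programs.\<close>

lemma enc_injective: "enc c = enc d \<Longrightarrow> c = d"
proof (induction c arbitrary: d rule: recf.induct)
  case (Comp f gs)
  then obtain f' gs' where d: "d = Comp f' gs'" "enc f = enc f'" "map enc gs = map enc gs'"
    by (cases d) (auto simp: prod_encode_eq list_encode_eq)
  have "gs = gs'"
    using d(3) Comp.IH(2) by (auto simp: list_eq_iff_nth_eq dest: map_eq_imp_length_eq)
  with d Comp.IH(1) show ?case by blast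
next
  case Zero
  then show ?case by (cases d) (auto simp: prod_encode_eq)
next
  case Succ
  then show ?case by (cases d) (auto simp: prod_encode_eq)
next
  case (Proj i)
  then show ?case by (cases d) (auto simp: prod_encode_eq)
next
  case (PrimRec f g)
  then show ?case by (cases d) (auto simp: prod_encode_eq)
next
  case (Minim f)
  then show ?case by (cases d) (auto simp: prod_encode_eq)
qed

lemma W_enc: "W (enc c) = {\<sigma>. \<exists>y. eval c [scode \<sigma>] y}"
  unfolding W_def using enc_injective by blast

section \<open>Computing program codes from parameters\<close>

lemma recursive_prod_encode:
  assumes "recursive n A" "recursive n B"
  shows "recursive n (\<lambda>e. prod_encode (A e, B e))"
  unfolding prod_encode_def triangle_def case_prod_conv
  by (intro recursive_add recursive_div recursive_mult recursive_Suc recursive_const assms)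

text \<open>Constant programs whose codes are obtained by iterating a fixed operation; they
  hard-wire parameters into a program.\<close>

fun const_recf :: "nat \<Rightarrow> recf" where
  "const_recf 0 = Zero"
| "const_recf (Suc k) = Comp Succ [const_recf k]"

lemma eval_const_recf: "eval (const_recf k) xs k"
proof (induction k)
  case (Suc k)
  show ?case by (simp, rule eval.comp[of _ _ "[k]"]) (simp_all add: Suc eval.succ)
qed (simp add: eval.zero)

lemma recursive_enc_const:
  assumes "recursive n A"
  shows "recursive n (\<lambda>e. enc (const_recf (A e)))"
proof -
  \<comment> \<open>\<open>Suc (prod_encode (acc, 0))\<close> is the \<open>list_encode\<close> of a
    one-element list.\<close>
  have "recursive n (\<lambda>e. rec_nat (enc Zero)
    (\<lambda>k acc. prod_encode (3, prod_encode (enc Succ, Suc (prod_encode (acc, 0))))) (A e))"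
    by (intro recursive_rec recursive_const recursive_prod_encode recursive_Suc recursive_proj assms) auto
  moreover have "rec_nat (enc Zero)
    (\<lambda>k acc. prod_encode (3, prod_encode (enc Succ, Suc (prod_encode (acc, 0))))) k = enc (const_recf k)" for k
    by (induction k) simp_all
  ultimately show ?thesis by simp
qed

lemma decidable_comp2:
  assumes "decidable 2 (\<lambda>e. T (e 0) (e 1))" "recursive n A" "recursive n B"
  shows "decidable n (\<lambda>e. T (A e) (B e))"
proof -
  have "recursive n ((\<lambda>i. if i = 0 then A else B) i)" for i using assms by simp
  from recursive_comp[OF assms(1)[unfolded decidable_def], of n "\<lambda>i. if i = 0 then A else B", OF this]
  show ?thesis by (simp add: decidable_def)
qed

lemma computable2_of_recursive:
  assumes "recursive 2 (\<lambda>e. g (e 0) (e 1))"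
  shows "computable2 g"
proof -
  obtain c where c: "\<And>e. eval c (map e [0..<2]) (g (e 0) (e 1))"
    using assms by (auto simp: recursive_def)
  have "eval c [x, y] (g x y)" for x y
    using c[of "\<lambda>i. if i = 0 then x else y"] by (simp add: upt_rec)
  then show ?thesis unfolding computable2_def by blast
qed

lemma computable1_of_recursive:
  assumes "recursive 1 (\<lambda>e. h (e 0))"
  shows "computable1 h"
proof -
  obtain c where c: "\<And>e. eval c (map e [0..<1]) (h (e 0))"
    using assms by (auto simp: recursive_def)
  have "eval c [x] (h x)" for x using c[of "\<lambda>i. x"] by simp
  then show ?thesis unfolding computable1_def by blast
qed

text \<open>An s-m-n theorem. Minimising \<open>\<not> D\<close> over a dummy variable halts at 0 if
  \<open>D\<close> holds and diverges otherwise; composing with constant programs fixes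
  \<open>a\<close> and \<open>b\<close>, and the code of the result is computable from them.\<close>

lemma decidable_family_index:
  assumes "decidable 3 (\<lambda>e. D (e 0) (e 1) (e 2))"
  obtains idx where "recursive 2 (\<lambda>e. idx (e 0) (e 1))" "\<And>a b. W (idx a b) = {\<sigma>. D (scode \<sigma>) a b}"
proof -
  have "recursive 4 (\<lambda>e. of_bool (\<not> D (e 1) (e 2) (e 3)))"
    using recursive_comp[OF decidable_not[OF assms, unfolded decidable_def], of 4 "\<lambda>i e. e (Suc i)"]
    by (simp add: recursive_proj numeral_eq_Suc)
  then obtain c where "\<And>e. eval c (map e [0..<4]) (of_bool (\<not> D (e 1) (e 2) (e 3)))"
    by (auto simp: recursive_def)
  from this[of "\<lambda>i. [k, x, a, b] ! i" for k x a b]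
  have c: "eval c [k, x, a, b] (of_bool (\<not> D x a b))" for k x a b
    by (simp add: upt_rec)
  have halts: "(\<exists>y. eval (Minim c) [x, a, b] y) \<longleftrightarrow> D x a b" for x a b
  proof
    assume "\<exists>y. eval (Minim c) [x, a, b] y"
    then obtain y where "eval c [y, x, a, b] 0" by (blast elim: eval_MinimE)
    with c[of y x a b] show "D x a b" by (auto dest: eval_deterministic)
  next
    assume "D x a b"
    with c[of 0 x a b] have "eval (Minim c) [x, a, b] 0" by (intro eval.minim) auto
    then show "\<exists>y. eval (Minim c) [x, a, b] y" ..
  qed
  define p where "p a b = Comp (Minim c) [Proj 0, const_recf a, const_recf b]" for a b
  have args: "list_all2 (\<lambda>g y. eval g [x] y) [Proj 0, const_recf a, const_recf b] ys \<longleftrightarrow> ys = [x, a, b]" for x a b ys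
  proof -
    have "eval (Proj 0) [x] y \<longleftrightarrow> y = x" for y
      using eval.proj[of 0 "[x]"] by (auto elim: eval_ProjE)
    moreover have "eval (const_recf k) [x] y \<longleftrightarrow> y = k" for k y
      using eval_const_recf eval_deterministic by blast
    ultimately show ?thesis by (auto simp: list_all2_Cons1)
  qed
  have p: "(\<exists>y. eval (p a b) [x] y) \<longleftrightarrow> D x a b" for a b x
  proof -
    have "eval (p a b) [x] y \<longleftrightarrow> eval (Minim c) [x, a, b] y" for y
    proof
      assume "eval (p a b) [x] y"
      then show "eval (Minim c) [x, a, b] y" unfolding p_def by (rule eval_CompE) (simp add: args)
    next
      assume "eval (Minim c) [x, a, b] y"
      then show "eval (p a b) [x] y" unfolding p_def using args by (blast intro: eval.comp)
    qed
    then show ?thesis using halts by simp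
  qed
  show ?thesis
  proof
    show "recursive 2 (\<lambda>e. enc (p (e 0) (e 1)))"
      unfolding p_def enc.simps list.map list_encode.simps
      by (intro recursive_prod_encode recursive_const recursive_Suc recursive_enc_const recursive_proj) auto
    show "W (enc (p a b)) = {\<sigma>. D (scode \<sigma>) a b}" for a b
      unfolding W_enc p ..
  qed
qed

text \<open>The first bit is the least significant one, so that taking prefixes is reduction modulo powers of 2.\<close>

definition prefix_code :: "(nat \<Rightarrow> bool) \<Rightarrow> nat \<Rightarrow> nat" where
  "prefix_code Z k = horner_sum of_bool 2 (map Z [0..<k])"

lemma prefix_code_less: "prefix_code Z k < 2 ^ k"
  using horner_sum_of_bool_2_less[of "map Z [0..<k]", where 'a = nat] by (simp add: prefix_code_def)

lemma prefix_code_mod: "k \<le> s \<Longrightarrow> prefix_code Z s mod 2 ^ k = prefix_code Z k"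
  unfolding prefix_code_def take_bit_eq_mod[symmetric] take_bit_horner_sum_bit_eq
  by (simp add: take_map)

lemma prefix_code_eq_iff: "prefix_code Z k = prefix_code Y k \<longleftrightarrow> (\<forall>i<k. Z i = Y i)"
proof
  assume "prefix_code Z k = prefix_code Y k"
  then have *: "bit (prefix_code Z k) i = bit (prefix_code Y k) i" for i by simp
  have "Z i = Y i" if "i < k" for i
    using *[of i] that unfolding prefix_code_def bit_horner_sum_bit_iff by simp
  then show "\<forall>i<k. Z i = Y i" by blast
next
  assume "\<forall>i<k. Z i = Y i"
  then show "prefix_code Z k = prefix_code Y k"
    unfolding prefix_code_def by (intro arg_cong[of _ _ "horner_sum _ _"]) auto
qed

lemma prefix_code_bit: "v < 2 ^ k \<Longrightarrow> prefix_code (bit v) k = v"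
  by (simp add: prefix_code_def horner_sum_bit_eq_take_bit take_bit_nat_eq_self)

text \<open>\<open>scode\<close> uses the binary digits 1 and 2 in place of 0 and 1; raising every
  digit by one adds \<open>2 ^ length bs - 1\<close>.\<close>

lemma scode_eq: "scode bs = horner_sum of_bool 2 bs + 2 ^ length bs - 1"
proof (induction bs)
  case (Cons b bs)
  have "(1 :: nat) \<le> 2 ^ length bs" by simp
  then obtain p :: nat where "2 ^ length bs = Suc p" by (metis Suc_le_D One_nat_def)
  with Cons show ?case by (simp add: horner_sum_simps)
qed simp

lemma scode_prefix: "scode (map Z [0..<k]) = prefix_code Z k + 2 ^ k - 1"
  by (simp add: scode_eq prefix_code_def)

lemma cyl_eq: "cyl U = {Z. \<exists>k. map Z [0..<k] \<in> U}"
proof -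
  have "(\<forall>i<length \<sigma>. Z i = \<sigma> ! i) \<longleftrightarrow> \<sigma> = map Z [0..<length \<sigma>]" for Z :: "nat \<Rightarrow> bool" and \<sigma>
    by (subst list_eq_iff_nth_eq) auto
  moreover have "(\<exists>\<sigma>\<in>U. \<sigma> = map Z [0..<length \<sigma>]) \<longleftrightarrow> (\<exists>k. map Z [0..<k] \<in> U)" for Z :: "nat \<Rightarrow> bool"
  proof
    assume "\<exists>k. map Z [0..<k] \<in> U"
    then obtain k where "map Z [0..<k] \<in> U" by blast
    then show "\<exists>\<sigma>\<in>U. \<sigma> = map Z [0..<length \<sigma>]"
      by (intro bexI[of _ "map Z [0..<k]"]) simp_all
  qed metis
  ultimately show ?thesis unfolding cyl_def by (simp only:)
qed

text \<open>The lightface Sigma-0-1 classes. The stage is at the same time the length of the prefix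
  inspected, so one parameter measures both.\<close>

definition effectively_open :: "(nat \<Rightarrow> bool) set \<Rightarrow> bool" where
  "effectively_open U \<longleftrightarrow>
     (\<exists>B. decidable 2 (\<lambda>e. B (e 0) (e 1)) \<and> U = {Z. \<exists>s. B (prefix_code Z s) s})"

text \<open>At stage \<open>s\<close>, accept if some prefix of length at most \<open>s\<close> has
  been enumerated within \<open>s\<close> steps. An index that codes no program gives the empty
  set.\<close>

lemma effectively_open_cyl_W: "effectively_open (cyl (W n))"
proof (cases "\<exists>c. enc c = n")
  case False
  then have "cyl (W n) = {Z. \<exists>s. False}" by (auto simp: W_def cyl_def)
  moreover have "decidable 2 (\<lambda>e. False)" unfolding decidable_def by (rule recursive_const)
  ultimately show ?thesis unfolding effectively_open_def by (intro exI[of _ "\<lambda>v s. False"]) simp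
next
  case True
  then obtain c where c: "n = enc c" by blast
  obtain T where T: "decidable 2 (\<lambda>e. T (e 0) (e 1))"
    "\<And>x s t. T x s \<Longrightarrow> s \<le> t \<Longrightarrow> T x t" "\<And>x. (\<exists>y. eval c [x] y) \<longleftrightarrow> (\<exists>s. T x s)"
    using domain_stages by blast
  \<comment> \<open>\<open>v mod 2 ^ k + 2 ^ k - 1\<close> is the string code of the prefix of
    length \<open>k\<close>.\<close>
  define B where "B v s \<longleftrightarrow> (\<exists>k<Suc s. T (v mod 2 ^ k + 2 ^ k - 1) s)" for v s
  have "decidable 2 (\<lambda>e. B (e 0) (e 1))"
    unfolding B_def
    by (intro decidable_bex decidable_comp2[OF T(1)] recursive_intros recursive_proj) auto
  moreover have "Z \<in> cyl (W n) \<longleftrightarrow> (\<exists>s. B (prefix_code Z s) s)" for Z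
  proof -
    have "Z \<in> cyl (W n) \<longleftrightarrow> (\<exists>k s. T (prefix_code Z k + 2 ^ k - 1) s)"
      unfolding cyl_eq c W_enc using T(3) by (simp add: scode_prefix)
    also have "\<dots> \<longleftrightarrow> (\<exists>s. B (prefix_code Z s) s)"
    proof
      assume "\<exists>k s. T (prefix_code Z k + 2 ^ k - 1) s"
      then obtain k s where ks: "T (prefix_code Z k + 2 ^ k - 1) s" by blast
      have "T (prefix_code Z (max k s) mod 2 ^ k + 2 ^ k - 1) (max k s)"
        using T(2)[OF ks, of "max k s"] by (simp add: prefix_code_mod)
      then show "\<exists>s. B (prefix_code Z s) s" unfolding B_def by (intro exI[of _ "max k s"] exI[of _ k]) simp
    next
      assume "\<exists>s. B (prefix_code Z s) s"
      then show "\<exists>k s. T (prefix_code Z k + 2 ^ k - 1) s"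
        unfolding B_def less_Suc_eq_le by (metis prefix_code_mod)
    qed
    finally show ?thesis .
  qed
  then have "cyl (W n) = {Z. \<exists>s. B (prefix_code Z s) s}" by blast
  ultimately show ?thesis unfolding effectively_open_def by (intro exI[of _ B]) simp
qed

lemma effectively_open_Un:
  assumes "effectively_open U" "effectively_open V"
  shows "effectively_open (U \<union> V)"
proof -
  obtain A B where A: "decidable 2 (\<lambda>e. A (e 0) (e 1))" "U = {Z. \<exists>s. A (prefix_code Z s) s}"
    and B: "decidable 2 (\<lambda>e. B (e 0) (e 1))" "V = {Z. \<exists>s. B (prefix_code Z s) s}"
    using assms by (auto simp: effectively_open_def)
  have "U \<union> V = {Z. \<exists>s. A (prefix_code Z s) s \<or> B (prefix_code Z s) s}"
    unfolding A(2) B(2) by blast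
  with decidable_disj[OF A(1) B(1)] show ?thesis unfolding effectively_open_def
    by (intro exI[of _ "\<lambda>v s. A v s \<or> B v s"]) simp
qed

text \<open>This makes the intersection of an effectively closed set with a cylinder effectively
  closed again.\<close>

lemma effectively_open_prefix_neq: "effectively_open {Z. prefix_code Z k \<noteq> v}"
proof -
  have "decidable 2 (\<lambda>e. e 1 = k \<and> e 0 \<noteq> v)"
    by (intro decidable_conj decidable_not decidable_eq recursive_const recursive_proj) auto
  moreover have "{Z. prefix_code Z k \<noteq> v} = {Z. \<exists>s. s = k \<and> prefix_code Z s \<noteq> v}" by simp
  ultimately show ?thesis unfolding effectively_open_def
    by (intro exI[of _ "\<lambda>w s. s = k \<and> w \<noteq> v"]) simp
qed

text \<open>Accepting once any shorter prefix has been accepted makes acceptance monotone in the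
  stage.\<close>

lemma effectively_open_stages:
  assumes "effectively_open U"
  obtains B where "decidable 2 (\<lambda>e. B (e 0) (e 1))" "U = {Z. \<exists>s. B (prefix_code Z s) s}"
    "\<And>Z s t. B (prefix_code Z s) s \<Longrightarrow> s \<le> t \<Longrightarrow> B (prefix_code Z t) t"
proof -
  obtain A where A: "decidable 2 (\<lambda>e. A (e 0) (e 1))" "U = {Z. \<exists>s. A (prefix_code Z s) s}"
    using assms by (auto simp: effectively_open_def)
  define B where "B v s \<longleftrightarrow> (\<exists>k<Suc s. A (v mod 2 ^ k) k)" for v s
  have B: "B (prefix_code Z s) s \<longleftrightarrow> (\<exists>k\<le>s. A (prefix_code Z k) k)" for Z s
    unfolding B_def less_Suc_eq_le by (auto simp: prefix_code_mod)
  show ?thesis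
  proof
    show "decidable 2 (\<lambda>e. B (e 0) (e 1))"
      unfolding B_def
      by (intro decidable_bex decidable_comp2[OF A(1)] recursive_intros recursive_proj) auto
    show "U = {Z. \<exists>s. B (prefix_code Z s) s}" unfolding A(2) B by auto
    show "B (prefix_code Z t) t" if "B (prefix_code Z s) s" "s \<le> t" for Z s t
      using that unfolding B by (meson le_trans)
  qed
qed

subsection \<open>Cylinders and measure\<close>

abbreviation cylinder :: "(nat \<Rightarrow> bool) \<Rightarrow> nat \<Rightarrow> (nat \<Rightarrow> bool) set" where
  "cylinder Z k \<equiv> {Y. prefix_code Y k = prefix_code Z k}"

lemma prefix_code_eq_mono:
  "prefix_code Y k = prefix_code Z k \<Longrightarrow> j \<le> k \<Longrightarrow> prefix_code Y j = prefix_code Z j"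
  by (metis prefix_code_mod)

section \<open>The uniform measure on cylinders\<close>

lemma prob_space_lam: "prob_space lam"
  unfolding lam_def by (intro prob_space_PiM measure_pmf.prob_space_axioms)

interpretation lam: prob_space lam
  by (rule prob_space_lam)

lemma prefix_set_eq_emb:
  assumes "v < 2 ^ k"
  shows "{Z. prefix_code Z k = v} =
    prod_emb UNIV (\<lambda>_. measure_pmf (bernoulli_pmf (1/2))) {..<k} (PiE {..<k} (\<lambda>i. {bit v i}))"
proof -
  have "prefix_code Z k = v \<longleftrightarrow> (\<forall>i<k. Z i = bit v i)" for Z
    using prefix_code_eq_iff[of Z k "bit v"] prefix_code_bit[OF assms] by simp
  then have "prefix_code Z k = v \<longleftrightarrow> restrict Z {..<k} \<in> PiE {..<k} (\<lambda>i. {bit v i})" for Z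
    unfolding restrict_PiE_iff by (simp add: Ball_def)
  then show ?thesis by (simp only: prod_emb_def PiE_UNIV_domain space_measure_pmf Pi_UNIV vimage_def) simp
qed

lemma sets_prefix_eq [measurable]: "{Z. prefix_code Z k = v} \<in> sets lam"
proof (cases "v < 2 ^ k")
  case True
  show ?thesis unfolding prefix_set_eq_emb[OF True] lam_def by (intro sets_PiM_I) auto
next
  case False
  then have "{Z. prefix_code Z k = v} = {}" using prefix_code_less by auto
  then show ?thesis by simp
qed

lemma measure_prefix_eq:
  assumes "v < 2 ^ k"
  shows "measure lam {Z. prefix_code Z k = v} = 1 / 2 ^ k"
proof -
  interpret product_prob_space "\<lambda>_ :: nat. measure_pmf (bernoulli_pmf (1/2))" UNIV
    by (intro product_prob_spaceI measure_pmf.prob_space_axioms)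
  have half: "measure (measure_pmf (bernoulli_pmf (1/2))) {b} = 1 / 2" for b
    by (cases b) (simp_all add: measure_pmf_single)
  show ?thesis
    unfolding prefix_set_eq_emb[OF assms] lam_def
    by (subst measure_PiM_emb) (simp_all add: half power_one_over del: One_nat_def)
qed

lemma prefix_pred_eq_Un: "{Z. P (prefix_code Z k)} = (\<Union>v\<in>{v. v < 2 ^ k \<and> P v}. {Z. prefix_code Z k = v})"
  using prefix_code_less by auto

lemma sets_prefix_pred: "{Z. P (prefix_code Z k)} \<in> sets lam"
  unfolding prefix_pred_eq_Un by (intro sets.finite_UN) auto

text \<open>Measures of clopen sets are string counts; this is what lets the construction compare
  measures decidably.\<close>

lemma measure_prefix_pred: "measure lam {Z. P (prefix_code Z k)} = card {v. v < 2 ^ k \<and> P v} / 2 ^ k"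
proof -
  have "measure lam {Z. P (prefix_code Z k)} = (\<Sum>v | v < 2 ^ k \<and> P v. measure lam {Z. prefix_code Z k = v})"
    unfolding prefix_pred_eq_Un
    by (intro lam.finite_measure_finite_Union) (auto simp: disjoint_family_on_def)
  also have "\<dots> = (\<Sum>v | v < 2 ^ k \<and> P v. 1 / 2 ^ k)"
    by (intro sum.cong) (auto simp: measure_prefix_eq)
  finally show ?thesis by simp
qed

text \<open>Openness in Cantor space expressed by prefixes; all later arguments use this
  form.\<close>

definition prefix_open :: "(nat \<Rightarrow> bool) set \<Rightarrow> bool" where
  "prefix_open U \<longleftrightarrow> (\<forall>Z\<in>U. \<exists>k. cylinder Z k \<subseteq> U)"

text \<open>A basic open set restricts finitely many coordinates, hence contains the cylinder given
  by any prefix of a member that reaches past them.\<close>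

lemma prefix_open_of_openin:
  assumes "openin cantor_top U"
  shows "prefix_open U"
  unfolding prefix_open_def
proof
  fix Z assume "Z \<in> U"
  with assms obtain X where X: "finite {i. X i \<noteq> (UNIV :: bool set)}" "Z \<in> PiE UNIV X" "PiE UNIV X \<subseteq> U"
    unfolding cantor_top_def openin_product_topology_alt by auto
  obtain k where k: "\<And>i. X i \<noteq> UNIV \<Longrightarrow> i < k"
    using finite_nat_bounded[OF X(1)] by auto
  have "Y i \<in> X i" if "prefix_code Y k = prefix_code Z k" for Y i
    using that X(2) k[of i] by (cases "X i = UNIV") (auto simp: prefix_code_eq_iff PiE_iff)
  with X(3) have "cylinder Z k \<subseteq> U" by (auto simp: PiE_iff)
  then show "\<exists>k. cylinder Z k \<subseteq> U" ..
qed

lemma prefix_open_of_effectively_open: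
  assumes "effectively_open U"
  shows "prefix_open U"
proof -
  obtain B where U: "U = {Z. \<exists>s. B (prefix_code Z s) s}"
    using assms by (auto simp: effectively_open_def)
  show ?thesis unfolding prefix_open_def U
  proof
    fix Z assume "Z \<in> {Z. \<exists>s. B (prefix_code Z s) s}"
    then obtain s where "B (prefix_code Z s) s" by blast
    then have "cylinder Z s \<subseteq> {Z. \<exists>s. B (prefix_code Z s) s}" by (auto intro: exI[of _ s])
    then show "\<exists>k. cylinder Z k \<subseteq> {Z. \<exists>s. B (prefix_code Z s) s}" ..
  qed
qed

text \<open>A countable union of cylinders; lengths below \<open>n\<close> can be avoided by
  lengthening prefixes.\<close>

lemma prefix_open_eq_Un:
  assumes "prefix_open U"
  shows "U = (\<Union>(k, v)\<in>{(k, v). n \<le> k \<and> {Z. prefix_code Z k = v} \<subseteq> U}. {Z. prefix_code Z k = v})"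
    (is "U = ?R")
proof
  show "U \<subseteq> ?R"
  proof
    fix Z assume "Z \<in> U"
    then obtain k where "cylinder Z k \<subseteq> U" using assms by (auto simp: prefix_open_def)
    moreover have "cylinder Z (max n k) \<subseteq> cylinder Z k"
      by (intro Collect_mono impI) (rule prefix_code_eq_mono, assumption, simp)
    ultimately have "cylinder Z (max n k) \<subseteq> U" by (rule order_trans[rotated])
    then show "Z \<in> ?R" by (intro UN_I[of "(max n k, prefix_code Z (max n k))"]) simp_all
  qed
qed auto

lemma sets_prefix_open:
  assumes "prefix_open U"
  shows "U \<in> sets lam"
  by (subst prefix_open_eq_Un[OF assms, of 0]) (intro sets.countable_UN', auto)

text \<open>Were \<open>P\<close> null in each of the countably many cylinders inside
  \<open>U\<close>, it would be null in \<open>U\<close>. The bound \<open>n\<close> lets a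
  construction force the prefixes to grow.\<close>

lemma positive_cylinder:
  assumes U: "prefix_open U" and P: "P \<in> sets lam" and pos: "0 < measure lam (P \<inter> U)"
  obtains Z k where "n \<le> k" "cylinder Z k \<subseteq> U" "0 < measure lam (P \<inter> cylinder Z k)"
proof -
  define J where "J = {(k, v). n \<le> k \<and> {Z. prefix_code Z k = v} \<subseteq> U}"
  have "\<exists>(k, v)\<in>J. 0 < measure lam (P \<inter> {Z. prefix_code Z k = v})"
  proof (rule ccontr)
    assume neg: "\<not> ?thesis"
    have "P \<inter> {Z. prefix_code Z k = v} \<in> null_sets lam" if "(k, v) \<in> J" for k v
    proof -
      have "measure lam (P \<inter> {Z. prefix_code Z k = v}) = 0"
        using neg that by (auto simp: zero_less_measure_iff)
      then show ?thesis using P by (simp add: null_sets_def lam.emeasure_eq_measure sets.Int)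
    qed
    then have "(\<Union>(k, v)\<in>J. P \<inter> {Z. prefix_code Z k = v}) \<in> null_sets lam"
      by (intro null_sets_UN') auto
    moreover have "P \<inter> U = (\<Union>(k, v)\<in>J. P \<inter> {Z. prefix_code Z k = v})"
      by (subst prefix_open_eq_Un[OF U, of n]) (auto simp: J_def)
    ultimately have "measure lam (P \<inter> U) = 0" by (simp add: measure_eq_0_null_sets)
    with pos show False by simp
  qed
  then obtain k v where kv: "(k, v) \<in> J" "0 < measure lam (P \<inter> {Z. prefix_code Z k = v})" by blast
  then have "P \<inter> {Z. prefix_code Z k = v} \<noteq> {}" by auto
  then obtain Z where "prefix_code Z k = v" by blast
  with kv that show thesis by (auto simp: J_def)
qed

lemma nested_cylinders_limit:
  assumes "\<And>n. prefix_code (Y (Suc n)) (k n) = prefix_code (Y n) (k n)" "\<And>n. k n < k (Suc n)"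
  obtains Z where "\<And>n. prefix_code Z (k n) = prefix_code (Y n) (k n)"
proof -
  have sm: "strict_mono k" using assms(2) by (simp add: strict_mono_Suc_iff)
  have agree: "prefix_code (Y (n + d)) (k n) = prefix_code (Y n) (k n)" for n d
  proof (induction d)
    case (Suc d)
    have "k n \<le> k (n + d)" using sm by (simp add: strict_mono_less_eq)
    then have "prefix_code (Y (Suc (n + d))) (k n) = prefix_code (Y (n + d)) (k n)"
      using prefix_code_eq_mono[OF assms(1)] by blast
    with Suc show ?case by simp
  qed simp
  \<comment> \<open>Bit \<open>i\<close> is read off at step \<open>Suc i\<close>, whose prefix is
    already longer than \<open>i\<close>.\<close>
  have "prefix_code (\<lambda>i. Y (Suc i) i) (k n) = prefix_code (Y n) (k n)" for n
    unfolding prefix_code_eq_iff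
  proof (intro allI impI)
    fix i assume i: "i < k n"
    have "i < k (Suc i)" using strict_mono_imp_increasing[OF sm, of "Suc i"] by simp
    show "Y (Suc i) i = Y n i"
    proof (cases "n \<le> Suc i")
      case True
      then show ?thesis using agree[of n "Suc i - n"] i by (simp add: prefix_code_eq_iff)
    next
      case False
      then show ?thesis
        using agree[of "Suc i" "n - Suc i"] \<open>i < k (Suc i)\<close> by (simp add: prefix_code_eq_iff)
    qed
  qed
  with that show thesis by blast
qed

text \<open>The forcing conditions, ordered by inclusion.\<close>

definition effectively_closed_positive :: "(nat \<Rightarrow> bool) set \<Rightarrow> bool" where
  "effectively_closed_positive Q \<longleftrightarrow> effectively_open (- Q) \<and> 0 < measure lam Q"

lemma sets_effectively_closed: "effectively_open (- Q) \<Longrightarrow> Q \<in> sets lam"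
  using sets_prefix_open[OF prefix_open_of_effectively_open, of "- Q"] sets.compl_sets[of "- Q" lam]
  by (simp add: lam_def space_PiM PiE_UNIV_domain Compl_eq_Diff_UNIV double_diff)

lemma prefix_code_Suc_split:
  "{Y. prefix_code Y k = v} \<subseteq> {Y. prefix_code Y (Suc k) = v} \<union> {Y. prefix_code Y (Suc k) = v + 2 ^ k}"
proof
  fix Y assume "Y \<in> {Y. prefix_code Y k = v}"
  moreover have "prefix_code Y (Suc k) = prefix_code Y k + (if Y k then 2 ^ k else 0)"
    by (simp add: prefix_code_def horner_sum_append)
  ultimately show "Y \<in> {Y. prefix_code Y (Suc k) = v} \<union> {Y. prefix_code Y (Suc k) = v + 2 ^ k}" by auto
qed

text \<open>Compactness of Cantor space, applied to the measure-theoretic supports of the \<open>Q n\<close>.\<close>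

lemma common_support_point:
  assumes sets: "\<And>n. Q n \<in> sets lam" and dec: "\<And>n. Q (Suc n) \<subseteq> Q n" and pos: "\<And>n. 0 < measure lam (Q n)"
  obtains Z where "\<And>n k. 0 < measure lam (Q n \<inter> cylinder Z k)"
proof -
  have antimono: "Q n \<subseteq> Q m" if "m \<le> n" for m n
    using lift_Suc_antimono_le[of Q, OF dec that] .
  \<comment> \<open>A finitely branching tree of prefixes that meet every \<open>Q n\<close> in
    positive measure; a path through it is the desired point.\<close>
  define good where "good k Z \<longleftrightarrow> (\<forall>n. 0 < measure lam (Q n \<inter> cylinder Z k))" for k Z
  have "\<exists>Y. \<forall>k. good k (Y k) \<and> prefix_code (Y (Suc k)) k = prefix_code (Y k) k"
  proof (rule dependent_nat_choice)
    show "\<exists>Z. good 0 Z" using pos by (simp add: good_def prefix_code_def)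
  next
    fix Z k assume Z: "good k Z"
    show "\<exists>Y. good (Suc k) Y \<and> prefix_code Y k = prefix_code Z k"
    proof (rule ccontr)
      assume neg: "\<not> ?thesis"
      have "\<exists>n. measure lam (Q n \<inter> {Y. prefix_code Y (Suc k) = v}) = 0"
        if v: "v mod 2 ^ k = prefix_code Z k" for v
      proof (rule ccontr)
        assume "\<not> ?thesis"
        then have p: "0 < measure lam (Q n \<inter> {Y. prefix_code Y (Suc k) = v})" for n
          by (simp add: zero_less_measure_iff)
        then have "Q 0 \<inter> {Y. prefix_code Y (Suc k) = v} \<noteq> {}" by (metis less_irrefl measure_empty)
        then obtain Y where Y: "prefix_code Y (Suc k) = v" by blast
        with p have "good (Suc k) Y" by (simp add: good_def)
        moreover have "prefix_code Y k = prefix_code Z k" using Y v prefix_code_mod[of k "Suc k" Y] by simp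
        ultimately show False using neg by blast
      qed
      then obtain a b where ab: "measure lam (Q a \<inter> {Y. prefix_code Y (Suc k) = prefix_code Z k}) = 0"
        "measure lam (Q b \<inter> {Y. prefix_code Y (Suc k) = prefix_code Z k + 2 ^ k}) = 0"
        by (metis mod_add_self2 mod_less prefix_code_less)
      \<comment> \<open>If the two one-bit extensions become null at \<open>a\<close> and
        \<open>b\<close>, then at the later of these indices the whole cylinder is null.\<close>
      let ?n = "max a b"
      have "Q ?n \<inter> cylinder Z k \<subseteq> (Q a \<inter> {Y. prefix_code Y (Suc k) = prefix_code Z k}) \<union>
          (Q b \<inter> {Y. prefix_code Y (Suc k) = prefix_code Z k + 2 ^ k})"
        using prefix_code_Suc_split[of k "prefix_code Z k"] antimono[of a ?n] antimono[of b ?n] by auto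
      then have "measure lam (Q ?n \<inter> cylinder Z k) \<le>
          measure lam ((Q a \<inter> {Y. prefix_code Y (Suc k) = prefix_code Z k}) \<union>
          (Q b \<inter> {Y. prefix_code Y (Suc k) = prefix_code Z k + 2 ^ k}))"
        using sets by (intro lam.finite_measure_mono) auto
      also have "\<dots> \<le> 0"
        using ab sets measure_Un_le[of "Q a \<inter> {Y. prefix_code Y (Suc k) = prefix_code Z k}"
            lam "Q b \<inter> {Y. prefix_code Y (Suc k) = prefix_code Z k + 2 ^ k}"] by simp
      finally show False using Z by (auto simp: good_def not_less[symmetric])
    qed
  qed
  then obtain Y where Y: "\<And>k. good k (Y k)" "\<And>k. prefix_code (Y (Suc k)) k = prefix_code (Y k) k" by blast
  obtain Z where "\<And>k. prefix_code Z k = prefix_code (Y k) k"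
    using nested_cylinders_limit[of Y "\<lambda>k. k"] Y(2) by auto
  with Y(1) show thesis by (intro that[of Z]) (simp add: good_def)
qed

subsection \<open>A Demuth test that is dense in an effectively closed set\<close>

text \<open>Each change reaches a new value in \<open>{1..b}\<close>, so changes inject into that
  set.\<close>

lemma mono_bounded_nat_changes:
  fixes a :: "nat \<Rightarrow> nat"
  assumes "mono a" "\<And>t. a t \<le> b"
  shows "finite {t. a (Suc t) \<noteq> a t}" "card {t. a (Suc t) \<noteq> a t} \<le> b"
proof -
  let ?C = "{t. a (Suc t) \<noteq> a t}"
  have inj: "inj_on (\<lambda>t. a (Suc t)) ?C"
  proof (rule linorder_inj_onI')
    fix s t assume "s \<in> ?C" "t \<in> ?C" "s < t"
    then have "a (Suc s) \<le> a t" "a t \<le> a (Suc t)" using monoD[OF assms(1)] by simp_all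
    with \<open>t \<in> ?C\<close> show "a (Suc s) \<noteq> a (Suc t)" by auto
  qed
  have img: "(\<lambda>t. a (Suc t)) ` ?C \<subseteq> {1..b}"
  proof safe
    fix t assume "a (Suc t) \<noteq> a t"
    with monoD[OF assms(1), of t "Suc t"] assms(2)[of "Suc t"] show "a (Suc t) \<in> {1..b}" by auto
  qed
  show "finite ?C" using inj_on_finite[OF inj img] by simp
  show "card ?C \<le> b" using card_inj_on_le[OF inj img] by simp
qed

text \<open>\<open>bad v s\<close> means that the string of length \<open>s\<close> with code
  \<open>v\<close> is seen at stage \<open>s\<close> to lie in the open set \<open>U\<close>, the
  complement of the condition.\<close>

locale effective_stages =
  fixes bad :: "nat \<Rightarrow> nat \<Rightarrow> bool"
  assumes bad_decidable: "decidable 2 (\<lambda>e. bad (e 0) (e 1))"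
    and bad_mono: "\<And>Z s t. bad (prefix_code Z s) s \<Longrightarrow> s \<le> t \<Longrightarrow> bad (prefix_code Z t) t"
begin

definition N :: "nat \<Rightarrow> (nat \<Rightarrow> bool) set" where
  "N s = {Z. bad (prefix_code Z s) s}"

definition U :: "(nat \<Rightarrow> bool) set" where
  "U = (\<Union>s. N s)"

text \<open>\<open>removed m s\<close> is the measure of \<open>N s\<close> in units of \<open>2 ^ -(m + 1)\<close>, rounded down; \<open>alive m L \<rho> s\<close> means that
  the cylinder of length \<open>len m L\<close> with code \<open>\<rho>\<close> has measure at least \<open>2 ^ -(len m L + L + m + 3)\<close> outside
  \<open>N s\<close>. With these constants, the finally selected cylinders for the \<open>2 ^ L\<close> strings of length \<open>L\<close> and the
  remainders of the abandoned ones have measure at most \<open>2 ^ -(L + m + 3)\<close> each.\<close>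

definition removed :: "nat \<Rightarrow> nat \<Rightarrow> nat" where
  "removed m s = card {v. v < 2 ^ s \<and> bad v s} * 2 ^ Suc m div 2 ^ s"

definition len :: "nat \<Rightarrow> nat \<Rightarrow> nat" where
  "len m L = 2 * L + m + 3"

definition alive :: "nat \<Rightarrow> nat \<Rightarrow> nat \<Rightarrow> nat \<Rightarrow> bool" where
  "alive m L \<rho> s \<longleftrightarrow>
     2 ^ s \<le> card {w. w < 2 ^ s \<and> (w mod 2 ^ len m L = \<rho> \<and> \<not> bad w s)} * 2 ^ (len m L + L + m + 3)"

text \<open>For the string of length \<open>L\<close> that begins \<open>w\<close>, the current
  choice is the alive extension of least code. Cylinders only die, so from stage
  \<open>len m L\<close> on the choice moves only to larger codes.\<close>

definition selected :: "nat \<Rightarrow> nat \<Rightarrow> nat \<Rightarrow> nat \<Rightarrow> bool" where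
  "selected m L w s \<longleftrightarrow> len m L \<le> s \<and> alive m L (w mod 2 ^ len m L) s \<and>
     (\<forall>\<rho><w mod 2 ^ len m L. \<rho> mod 2 ^ L = w mod 2 ^ L \<longrightarrow> \<not> alive m L \<rho> s)"

text \<open>The parameter \<open>q\<close> delays the enumeration until \<open>removed\<close> has
  reached it; raising \<open>q\<close> is a fresh start. The bound \<open>L<s\<close> keeps the
  predicate decidable.\<close>

definition enumerated :: "nat \<Rightarrow> nat \<Rightarrow> nat \<Rightarrow> nat \<Rightarrow> bool" where
  "enumerated m q w s \<longleftrightarrow> \<not> bad w s \<and> q \<le> removed m s \<and> (\<exists>L<s. selected m L w s)"

section \<open>Limits of the stage approximations\<close>

lemma N_mono: "s \<le> t \<Longrightarrow> N s \<subseteq> N t"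
  unfolding N_def using bad_mono by blast

lemma sets_N [measurable]: "N s \<in> sets lam"
  unfolding N_def by (rule sets_prefix_pred)

lemma sets_U [measurable]: "U \<in> sets lam"
  unfolding U_def by (intro sets.countable_UN) (auto simp: sets_N)

lemma measure_diff_N_tendsto:
  assumes "A \<in> sets lam"
  shows "(\<lambda>s. measure lam (A - N s)) \<longlonglongrightarrow> measure lam (A - U)"
proof -
  have "(\<lambda>s. measure lam (A - N s)) \<longlonglongrightarrow> measure lam (\<Inter>s. A - N s)"
    using assms by (intro lam.finite_Lim_measure_decseq) (auto simp: decseq_def dest: N_mono)
  moreover have "(\<Inter>s. A - N s) = A - U" by (auto simp: U_def)
  ultimately show ?thesis by simp
qed

text \<open>Once \<open>s\<close> is at least \<open>len m L\<close>, the prefix of length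
  \<open>s\<close> determines the shorter one, and the count in \<open>alive\<close> is a measure in
  units of \<open>1 / 2 ^ s\<close>.\<close>

lemma alive_iff:
  assumes "len m L \<le> s"
  shows "alive m L \<rho> s \<longleftrightarrow> 1 / 2 ^ (len m L + L + m + 3) \<le> measure lam ({Z. prefix_code Z (len m L) = \<rho>} - N s)"
proof -
  have "{Z. prefix_code Z (len m L) = \<rho>} - N s =
      {Z. prefix_code Z s mod 2 ^ len m L = \<rho> \<and> \<not> bad (prefix_code Z s) s}"
    using prefix_code_mod[OF assms] by (auto simp: N_def)
  then have "measure lam ({Z. prefix_code Z (len m L) = \<rho>} - N s) =
      card {w. w < 2 ^ s \<and> (w mod 2 ^ len m L = \<rho> \<and> \<not> bad w s)} / 2 ^ s"
    using measure_prefix_pred[of "\<lambda>w. w mod 2 ^ len m L = \<rho> \<and> \<not> bad w s" s] by simp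
  moreover have "1 / 2 ^ a \<le> real c / 2 ^ s \<longleftrightarrow> 2 ^ s \<le> c * 2 ^ a" for a c
  proof -
    have "1 / 2 ^ a \<le> real c / 2 ^ s \<longleftrightarrow> real (2 ^ s) \<le> real (c * 2 ^ a)"
      by (simp add: divide_simps)
    then show ?thesis by (simp only: of_nat_le_iff)
  qed
  ultimately show ?thesis unfolding alive_def by simp
qed

lemma alive_antimono:
  assumes "len m L \<le> s" "s \<le> t" "alive m L \<rho> t"
  shows "alive m L \<rho> s"
proof -
  have "measure lam ({Z. prefix_code Z (len m L) = \<rho>} - N t) \<le> measure lam ({Z. prefix_code Z (len m L) = \<rho>} - N s)"
    using N_mono[OF assms(2)] by (intro lam.finite_measure_mono) auto
  with assms show ?thesis by (simp add: alive_iff)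
qed

definition immortal :: "nat \<Rightarrow> nat \<Rightarrow> nat \<Rightarrow> bool" where
  "immortal m L \<rho> \<longleftrightarrow> (\<forall>s\<ge>len m L. alive m L \<rho> s)"

text \<open>The threshold is a non-strict lower bound, so it survives the passage to the limit along
  \<open>N s\<close>.\<close>

lemma immortal_iff:
  "immortal m L \<rho> \<longleftrightarrow> 1 / 2 ^ (len m L + L + m + 3) \<le> measure lam ({Z. prefix_code Z (len m L) = \<rho>} - U)"
proof
  assume "immortal m L \<rho>"
  then have "\<forall>\<^sub>F s in sequentially. 1 / 2 ^ (len m L + L + m + 3) \<le> measure lam ({Z. prefix_code Z (len m L) = \<rho>} - N s)"
    by (auto simp: immortal_def alive_iff eventually_sequentially)
  then show "1 / 2 ^ (len m L + L + m + 3) \<le> measure lam ({Z. prefix_code Z (len m L) = \<rho>} - U)"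
    by (rule tendsto_lowerbound[OF measure_diff_N_tendsto[OF sets_prefix_eq]]) simp
next
  assume le: "1 / 2 ^ (len m L + L + m + 3) \<le> measure lam ({Z. prefix_code Z (len m L) = \<rho>} - U)"
  have "measure lam ({Z. prefix_code Z (len m L) = \<rho>} - U) \<le> measure lam ({Z. prefix_code Z (len m L) = \<rho>} - N s)" for s
    by (intro lam.finite_measure_mono) (auto simp: U_def)
  with le show "immortal m L \<rho>" unfolding immortal_def by (auto simp: alive_iff intro: order_trans)
qed

lemma removed_bounds:
  "real (removed m s) \<le> measure lam (N s) * 2 ^ Suc m" "measure lam (N s) * 2 ^ Suc m < real (removed m s) + 1"
proof -
  define c where "c = card {v. v < 2 ^ s \<and> bad v s}"
  have N: "measure lam (N s) = real c / 2 ^ s"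
    unfolding N_def c_def by (rule measure_prefix_pred)
  have "removed m s * 2 ^ s \<le> c * 2 ^ Suc m" "c * 2 ^ Suc m < Suc (removed m s) * 2 ^ s"
    unfolding removed_def c_def[symmetric]
    using div_times_less_eq_dividend[of "c * 2 ^ Suc m" "2 ^ s"] dividend_less_times_div[of "2 ^ s" "c * 2 ^ Suc m"]
    by (simp_all add: algebra_simps)
  then have "real (removed m s * 2 ^ s) \<le> real (c * 2 ^ Suc m)" "real (c * 2 ^ Suc m) < real (Suc (removed m s) * 2 ^ s)"
    by (simp_all only: of_nat_le_iff of_nat_less_iff)
  then show "real (removed m s) \<le> measure lam (N s) * 2 ^ Suc m" "measure lam (N s) * 2 ^ Suc m < real (removed m s) + 1"
    unfolding N by (simp_all add: field_simps)
qed

lemma removed_mono: "mono (removed m)"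
proof (rule monoI)
  fix s t :: nat assume "s \<le> t"
  then have "measure lam (N s) \<le> measure lam (N t)"
    using N_mono by (intro lam.finite_measure_mono) auto
  then have "measure lam (N s) * 2 ^ Suc m \<le> measure lam (N t) * 2 ^ Suc m" by simp
  then have "real (removed m s) < real (removed m t) + 1"
    using removed_bounds(1)[of m s] removed_bounds(2)[of t m] by linarith
  then show "removed m s \<le> removed m t" by linarith
qed

lemma removed_le: "removed m s \<le> 2 ^ Suc m"
proof -
  have "real (removed m s) \<le> measure lam (N s) * 2 ^ Suc m" by (rule removed_bounds(1))
  also have "\<dots> \<le> 1 * 2 ^ Suc m" by (intro mult_right_mono) simp_all
  finally have "real (removed m s) \<le> real (2 ^ Suc m)" by simp
  then show ?thesis by (simp only: of_nat_le_iff)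
qed

text \<open>The limit of the bounded nondecreasing sequence \<open>removed m\<close>, attained from
  stage \<open>start m\<close> on.\<close>

definition final_removed :: "nat \<Rightarrow> nat" where
  "final_removed m = Max (range (removed m))"

lemma finite_range_removed: "finite (range (removed m))"
  by (rule finite_subset[of _ "{..2 ^ Suc m}"]) (use removed_le in auto)

lemma removed_le_final: "removed m s \<le> final_removed m"
  unfolding final_removed_def by (intro Max_ge finite_range_removed) auto

definition start :: "nat \<Rightarrow> nat" where
  "start m = (LEAST s. final_removed m \<le> removed m s)"

lemma final_removed_le_iff: "final_removed m \<le> removed m s \<longleftrightarrow> start m \<le> s"
proof -
  obtain s' where "final_removed m = removed m s'"
    unfolding final_removed_def using Max_in[OF finite_range_removed] by auto
  then have "final_removed m \<le> removed m (start m)"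
    unfolding start_def by (rule LeastI[OF eq_refl])
  moreover have "start m \<le> s" if "final_removed m \<le> removed m s"
    unfolding start_def using that by (rule Least_le)
  ultimately show ?thesis
    using monoD[OF removed_mono[of m], of "start m" s] order_trans by blast
qed

text \<open>From \<open>start m\<close> on the rounded value is constant, so less than one unit of
  measure can still leave at any later stage; the limit gives the bound.\<close>

lemma measure_U_diff_start: "measure lam (U - N (start m)) \<le> 1 / 2 ^ Suc m"
proof -
  have "measure lam (N s - N (start m)) \<le> 1 / 2 ^ Suc m" if "start m \<le> s" for s
  proof -
    have "removed m s = removed m (start m)"
      using final_removed_le_iff[of m] removed_le_final[of m] that by (metis le_antisym order_refl)
    then have "measure lam (N s) * 2 ^ Suc m - measure lam (N (start m)) * 2 ^ Suc m \<le> 1"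
      using removed_bounds(2)[of s m] removed_bounds(1)[of m "start m"] by simp
    moreover have "measure lam (N s - N (start m)) = measure lam (N s) - measure lam (N (start m))"
      using N_mono[OF that] by (intro lam.finite_measure_Diff) auto
    ultimately have "measure lam (N s - N (start m)) * 2 ^ Suc m \<le> 1" by (simp only: left_diff_distrib)
    then show ?thesis by (simp only: pos_le_divide_eq zero_less_power zero_less_numeral)
  qed
  then have "\<forall>\<^sub>F s in sequentially. measure lam (N s - N (start m)) \<le> 1 / 2 ^ Suc m"
    by (auto simp: eventually_sequentially)
  moreover have "(\<lambda>s. measure lam (N s - N (start m))) \<longlonglongrightarrow> measure lam (\<Union>s. N s - N (start m))"
    by (intro lam.finite_Lim_measure_incseq) (auto simp: incseq_def dest: N_mono)
  ultimately have "measure lam (\<Union>s. N s - N (start m)) \<le> 1 / 2 ^ Suc m"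
    by (intro tendsto_upperbound[of "\<lambda>s. measure lam (N s - N (start m))"]) auto
  moreover have "(\<Union>s. N s - N (start m)) = U - N (start m)" by (auto simp: U_def)
  ultimately show ?thesis by simp
qed

section \<open>The test components and their measure\<close>

definition component :: "nat \<Rightarrow> (nat \<Rightarrow> bool) set" where
  "component m = {Z. \<exists>s. enumerated m (final_removed m) (prefix_code Z s) s}"

text \<open>The cylinders selected in the limit: for each string of length \<open>L\<close>, the
  least immortal one extending it, if any.\<close>

definition leaders :: "nat \<Rightarrow> nat \<Rightarrow> nat set" where
  "leaders m L = {\<rho>. \<rho> < 2 ^ len m L \<and> immortal m L \<rho> \<and>
     (\<forall>\<rho>'<\<rho>. \<rho>' mod 2 ^ L = \<rho> mod 2 ^ L \<longrightarrow> \<not> immortal m L \<rho>')}"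

text \<open>The final choices in full, together with what is left outside \<open>U\<close> of every
  mortal cylinder, in particular of the abandoned ones.\<close>

definition cover :: "nat \<Rightarrow> nat \<Rightarrow> (nat \<Rightarrow> bool) set" where
  "cover m L = (\<Union>\<rho>\<in>leaders m L. {Z. prefix_code Z (len m L) = \<rho>}) \<union>
     (\<Union>\<rho>\<in>{\<rho>. \<rho> < 2 ^ len m L \<and> \<not> immortal m L \<rho>}. {Z. prefix_code Z (len m L) = \<rho>} - U)"

text \<open>A point is enumerated at some stage \<open>s\<close> after \<open>start m\<close>,
  outside \<open>N s\<close>. If it lies in \<open>U\<close>, it is wasted measure. Otherwise its
  selected cylinder is mortal, or it is a leader because all smaller competitors are already dead at
  \<open>s\<close>.\<close>

lemma component_subset: "component m \<subseteq> (U - N (start m)) \<union> (\<Union>L. cover m L)"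
proof
  fix Z assume "Z \<in> component m"
  then obtain s L where s: "\<not> bad (prefix_code Z s) s" "start m \<le> s" "selected m L (prefix_code Z s) s"
    by (auto simp: component_def enumerated_def final_removed_le_iff)
  have "Z \<notin> N (start m)" using s(1) N_mono[OF s(2)] by (auto simp: N_def)
  moreover have "Z \<in> cover m L" if "Z \<notin> U"
  proof -
    define \<rho> where "\<rho> = prefix_code Z (len m L)"
    have len: "len m L \<le> s" "L \<le> len m L" using s(3) by (auto simp: selected_def len_def)
    have \<rho>: "prefix_code Z s mod 2 ^ len m L = \<rho>" "prefix_code Z s mod 2 ^ L = \<rho> mod 2 ^ L" "\<rho> < 2 ^ len m L"
      using len prefix_code_less by (simp_all add: \<rho>_def prefix_code_mod)
    show ?thesis
    proof (cases "immortal m L \<rho>")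
      case True
      have "\<not> immortal m L \<rho>'" if "\<rho>' < \<rho>" "\<rho>' mod 2 ^ L = \<rho> mod 2 ^ L" for \<rho>'
        using s(3) that len(1) unfolding selected_def \<rho>(1,2) immortal_def by blast
      with True \<rho>(3) have "\<rho> \<in> leaders m L" by (simp add: leaders_def)
      then show ?thesis by (auto simp: cover_def \<rho>_def)
    next
      case False
      with \<rho>(3) \<open>Z \<notin> U\<close> show ?thesis by (auto simp: cover_def \<rho>_def)
    qed
  qed
  ultimately show "Z \<in> (U - N (start m)) \<union> (\<Union>L. cover m L)" by blast
qed

lemma finite_leaders: "finite (leaders m L)"
  unfolding leaders_def by simp

text \<open>Of two leaders extending the same string, the smaller would exclude the larger.\<close>

lemma card_leaders: "card (leaders m L) \<le> 2 ^ L"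
proof -
  have "inj_on (\<lambda>\<rho>. \<rho> mod 2 ^ L) (leaders m L)"
  proof (rule linorder_inj_onI')
    fix \<rho> \<rho>' assume "\<rho> \<in> leaders m L" "\<rho>' \<in> leaders m L" "\<rho> < \<rho>'"
    then show "\<rho> mod 2 ^ L \<noteq> \<rho>' mod 2 ^ L" unfolding leaders_def by blast
  qed
  moreover have "(\<lambda>\<rho>. \<rho> mod 2 ^ L) ` leaders m L \<subseteq> {..<2 ^ L}" by auto
  ultimately have "card (leaders m L) \<le> card {..<(2 :: nat) ^ L}" by (intro card_inj_on_le) auto
  then show ?thesis by simp
qed

lemma sets_cover [measurable]: "cover m L \<in> sets lam"
  unfolding cover_def by (intro sets.Un sets.finite_UN sets.Diff sets_prefix_eq sets_U) (auto simp: finite_leaders)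

lemma measure_UN_le_card_mult:
  fixes c :: real
  assumes "finite I" "\<And>i. i \<in> I \<Longrightarrow> A i \<in> sets lam" "\<And>i. i \<in> I \<Longrightarrow> measure lam (A i) \<le> c"
  shows "measure lam (\<Union>i\<in>I. A i) \<le> card I * c"
proof -
  have "measure lam (\<Union>i\<in>I. A i) \<le> (\<Sum>i\<in>I. measure lam (A i))"
    using assms by (intro lam.finite_measure_subadditive_finite) auto
  also have "\<dots> \<le> (\<Sum>i\<in>I. c)" by (intro sum_mono assms)
  finally show ?thesis by simp
qed

text \<open>At most \<open>2 ^ L\<close> leaders of measure \<open>1 / 2 ^ len m L\<close>, and at
  most \<open>2 ^ len m L\<close> mortal remainders below the threshold; either family contributes
  at most \<open>1 / 2 ^ (L + m + 3)\<close>.\<close>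

lemma measure_cover: "measure lam (cover m L) \<le> (1 / 2) ^ (L + m + 2)"
proof -
  let ?l = "len m L"
  let ?A = "\<Union>\<rho>\<in>leaders m L. {Z. prefix_code Z ?l = \<rho>}"
  let ?D = "{\<rho>. \<rho> < 2 ^ ?l \<and> \<not> immortal m L \<rho>}"
  let ?B = "\<Union>\<rho>\<in>?D. {Z. prefix_code Z ?l = \<rho>} - U"
  have "measure lam ?A \<le> card (leaders m L) * (1 / 2 ^ ?l)"
    by (intro measure_UN_le_card_mult finite_leaders) (auto simp: measure_prefix_eq leaders_def)
  also have "\<dots> \<le> real (2 ^ L) * (1 / 2 ^ ?l)"
    using card_leaders[of m L] by (intro mult_right_mono) (simp_all only: of_nat_le_iff, simp)
  also have "\<dots> = 1 / 2 ^ (L + m + 3)" 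
  proof -
    have "2 ^ ?l = (2 :: real) ^ L * 2 ^ (L + m + 3)" by (simp add: len_def flip: power_add)
    then show ?thesis by simp
  qed
  finally have A: "measure lam ?A \<le> 1 / 2 ^ (L + m + 3)" .
  have "measure lam ?B \<le> card ?D * (1 / 2 ^ (?l + L + m + 3))"
    by (intro measure_UN_le_card_mult) (auto simp: immortal_iff)
  also have "\<dots> \<le> real (2 ^ ?l) * (1 / 2 ^ (?l + L + m + 3))"
  proof -
    have "card ?D \<le> card {..<(2 :: nat) ^ ?l}" by (intro card_mono) auto
    then show ?thesis by (intro mult_right_mono) (simp_all only: of_nat_le_iff card_lessThan, simp)
  qed
  also have "\<dots> = 1 / 2 ^ (L + m + 3)" by (simp add: power_add field_simps)
  finally have B: "measure lam ?B \<le> 1 / 2 ^ (L + m + 3)" .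
  have "measure lam (cover m L) \<le> measure lam ?A + measure lam ?B"
    unfolding cover_def by (intro measure_Un_le sets.finite_UN sets.Diff sets_prefix_eq sets_U) (auto simp: finite_leaders)
  also have "\<dots> \<le> 1 / 2 ^ (L + m + 3) + 1 / 2 ^ (L + m + 3)" using A B by (rule add_mono)
  also have "\<dots> = (1 / 2) ^ (L + m + 2)" by (simp add: power_one_over power_add field_simps)
  finally show ?thesis .
qed

lemma measure_Union_cover: "measure lam (\<Union>L. cover m L) \<le> (1 / 2) ^ Suc m"
proof -
  have sums: "(\<lambda>L. (1 / 2) ^ (L + m + 2)) sums ((1 / 2 :: real) ^ Suc m)"
    using sums_mult2[OF power_half_series, of "(1 / 2) ^ Suc m"] by (simp add: power_add mult_ac)
  have summable: "summable (\<lambda>L. measure lam (cover m L))"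
    by (rule summable_comparison_test'[OF sums_summable[OF sums], of 0]) (use measure_cover in simp)
  have "measure lam (\<Union>L. cover m L) \<le> (\<Sum>L. measure lam (cover m L))"
    using summable by (intro lam.finite_measure_subadditive_countably) auto
  also have "\<dots> \<le> (\<Sum>L. (1 / 2) ^ (L + m + 2))"
    by (intro suminf_le measure_cover summable sums_summable[OF sums])
  also have "\<dots> = (1 / 2) ^ Suc m" using sums by (rule sums_unique[symmetric])
  finally show ?thesis .
qed

text \<open>Half of the allowance pays for points that leave after \<open>start m\<close>, the other
  half for the covers of all lengths \<open>L\<close>.\<close>

lemma measure_component: "measure lam (component m) \<le> (1 / 2) ^ m"
proof -
  have "measure lam (component m) \<le> measure lam ((U - N (start m)) \<union> (\<Union>L. cover m L))"
    using component_subset by (intro lam.finite_measure_mono) auto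
  also have "\<dots> \<le> measure lam (U - N (start m)) + measure lam (\<Union>L. cover m L)"
    by (intro measure_Un_le) auto
  also have "\<dots> \<le> 1 / 2 ^ Suc m + (1 / 2) ^ Suc m"
    by (intro add_mono measure_U_diff_start measure_Union_cover)
  also have "\<dots> = (1 / 2) ^ m" by (simp add: power_one_over field_simps)
  finally show ?thesis .
qed

text \<open>The finitely many smaller competitors of a leader are mortal, so from some stage on all
  are dead and the leader is selected.\<close>

lemma leader_subset_component:
  assumes \<rho>: "\<rho> \<in> leaders m L"
  shows "{Z. prefix_code Z (len m L) = \<rho>} - U \<subseteq> component m"
proof -
  have "\<exists>s. \<forall>\<rho>'<\<rho>. \<rho>' mod 2 ^ L = \<rho> mod 2 ^ L \<longrightarrow> len m L \<le> s \<and> \<not> alive m L \<rho>' s"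
  proof (rule uniform_stage)
    fix \<rho>' assume "\<rho>' < \<rho>"
    with \<rho> show "\<exists>s. \<rho>' mod 2 ^ L = \<rho> mod 2 ^ L \<longrightarrow> len m L \<le> s \<and> \<not> alive m L \<rho>' s"
      unfolding leaders_def immortal_def by blast
  next
    fix \<rho>' s t assume "\<rho>' mod 2 ^ L = \<rho> mod 2 ^ L \<longrightarrow> len m L \<le> s \<and> \<not> alive m L \<rho>' s" "s \<le> t"
    then show "\<rho>' mod 2 ^ L = \<rho> mod 2 ^ L \<longrightarrow> len m L \<le> t \<and> \<not> alive m L \<rho>' t"
      using alive_antimono by (meson order_trans)
  qed
  then obtain r where r: "\<And>\<rho>'. \<rho>' < \<rho> \<Longrightarrow> \<rho>' mod 2 ^ L = \<rho> mod 2 ^ L \<Longrightarrow> len m L \<le> r \<and> \<not> alive m L \<rho>' r"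
    by blast
  \<comment> \<open>Late enough for the competitors to be dead, the last start to have happened, the
    length to be reached, and \<open>L < s\<close>.\<close>
  define s where "s = r + start m + len m L + Suc L"
  show ?thesis
  proof
    fix Z assume Z: "Z \<in> {Z. prefix_code Z (len m L) = \<rho>} - U"
    then have "\<not> bad (prefix_code Z s) s" by (auto simp: U_def N_def)
    moreover have "final_removed m \<le> removed m s" by (simp add: final_removed_le_iff s_def)
    moreover have "selected m L (prefix_code Z s) s"
    proof -
      have code: "prefix_code Z s mod 2 ^ len m L = \<rho>" "prefix_code Z s mod 2 ^ L = \<rho> mod 2 ^ L"
      proof -
        show "prefix_code Z s mod 2 ^ len m L = \<rho>" using Z by (simp add: prefix_code_mod s_def)
        have "\<rho> = prefix_code Z (len m L)" using Z by simp
        then have "\<rho> mod 2 ^ L = prefix_code Z L" by (simp add: prefix_code_mod len_def)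
        then show "prefix_code Z s mod 2 ^ L = \<rho> mod 2 ^ L" by (simp add: prefix_code_mod s_def)
      qed
      have "alive m L \<rho> s" using \<rho> by (simp add: leaders_def immortal_def s_def)
      moreover have "\<not> alive m L \<rho>' s" if "\<rho>' < \<rho>" "\<rho>' mod 2 ^ L = \<rho> mod 2 ^ L" for \<rho>'
        using r[OF that] alive_antimono[of m L r s \<rho>'] by (auto simp: s_def)
      moreover have "len m L \<le> s" by (simp add: s_def)
      ultimately show ?thesis unfolding selected_def code by blast
    qed
    moreover have "L < s" by (simp add: s_def)
    ultimately show "Z \<in> component m" unfolding component_def enumerated_def by blast
  qed
qed

text \<open>For large \<open>L\<close>, mortal pieces are too small to fill the given portion, so it
  meets an immortal cylinder. The leader sharing its first \<open>L\<close> bits may be another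
  cylinder, but since \<open>k \<le> L\<close> it too lies in the given one.\<close>

lemma component_dense:
  assumes pos: "0 < measure lam ({Z. prefix_code Z k = v} - U)" and sets: "component m \<in> sets lam"
  shows "0 < measure lam (({Z. prefix_code Z k = v} - U) \<inter> component m)"
proof -
  let ?C = "{Z. prefix_code Z k = v} - U"
  obtain i where i: "(1 / 2 :: real) ^ i < measure lam ?C" using real_arch_pow_inv[OF pos, of "1 / 2"] by auto
  \<comment> \<open>Adding \<open>k\<close> makes strings of length \<open>L\<close> decide the
    given cylinder; adding \<open>i\<close> makes \<open>1 / 2 ^ L\<close> smaller than the measure
    to be filled.\<close>
  define L where "L = i + k"
  let ?l = "len m L"
  have "\<exists>\<rho><2 ^ ?l. 1 / 2 ^ (?l + L + m + 3) \<le> measure lam (?C \<inter> {Z. prefix_code Z ?l = \<rho>})"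
  proof (rule ccontr)
    assume neg: "\<not> ?thesis"
    have "?C = (\<Union>\<rho>\<in>{..<2 ^ ?l}. ?C \<inter> {Z. prefix_code Z ?l = \<rho>})" using prefix_code_less by auto
    then have "measure lam ?C = measure lam (\<Union>\<rho>\<in>{..<2 ^ ?l}. ?C \<inter> {Z. prefix_code Z ?l = \<rho>})" by simp
    also have "\<dots> \<le> card {..<(2 :: nat) ^ ?l} * (1 / 2 ^ (?l + L + m + 3))"
      using neg by (intro measure_UN_le_card_mult) (auto simp: not_le less_imp_le)
    also have "\<dots> = (1 / 2) ^ (L + m + 3)" by (simp add: power_add power_one_over field_simps)
    also have "\<dots> \<le> (1 / 2) ^ i" by (intro power_decreasing) (auto simp: L_def)
    finally show False using i by simp
  qed
  then obtain \<rho> where \<rho>: "\<rho> < 2 ^ ?l" "1 / 2 ^ (?l + L + m + 3) \<le> measure lam (?C \<inter> {Z. prefix_code Z ?l = \<rho>})"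
    by blast
  have "measure lam (?C \<inter> {Z. prefix_code Z ?l = \<rho>}) \<le> measure lam ({Z. prefix_code Z ?l = \<rho>} - U)"
    by (intro lam.finite_measure_mono) auto
  with \<rho>(2) have immortal: "immortal m L \<rho>" by (simp add: immortal_iff)
  have "0 < measure lam (?C \<inter> {Z. prefix_code Z ?l = \<rho>})"
    using \<rho>(2) by (rule less_le_trans[rotated]) simp
  then have "?C \<inter> {Z. prefix_code Z ?l = \<rho>} \<noteq> {}" by (metis less_irrefl measure_empty)
  then obtain Z where Z: "prefix_code Z k = v" "prefix_code Z ?l = \<rho>" by auto
  have "k \<le> L" "L \<le> ?l" by (simp_all add: L_def len_def)
  define \<rho>\<^sub>0 where "\<rho>\<^sub>0 = (LEAST \<rho>'. immortal m L \<rho>' \<and> \<rho>' mod 2 ^ L = \<rho> mod 2 ^ L)"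
  have \<rho>\<^sub>0: "immortal m L \<rho>\<^sub>0" "\<rho>\<^sub>0 mod 2 ^ L = \<rho> mod 2 ^ L"
    using LeastI[of "\<lambda>\<rho>'. immortal m L \<rho>' \<and> \<rho>' mod 2 ^ L = \<rho> mod 2 ^ L" \<rho>] immortal by (simp_all add: \<rho>\<^sub>0_def)
  have least: "\<rho>\<^sub>0 \<le> \<rho>'" if "immortal m L \<rho>'" "\<rho>' mod 2 ^ L = \<rho> mod 2 ^ L" for \<rho>'
    unfolding \<rho>\<^sub>0_def using that by (intro Least_le) simp
  have leader: "\<rho>\<^sub>0 \<in> leaders m L"
    using \<rho>\<^sub>0 least[OF immortal] least \<rho>(1) by (force simp: leaders_def)
  have "{Z. prefix_code Z ?l = \<rho>\<^sub>0} - U \<subseteq> ?C \<inter> component m"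
  proof -
    have "prefix_code Y k = v" if "prefix_code Y ?l = \<rho>\<^sub>0" for Y
    proof -
      have "prefix_code Y L = prefix_code Z L"
        using \<rho>\<^sub>0(2) that Z(2) \<open>L \<le> ?l\<close> prefix_code_mod[of L ?l] by metis
      with Z(1) \<open>k \<le> L\<close> show ?thesis using prefix_code_eq_mono by blast
    qed
    with leader_subset_component[OF leader] show ?thesis by blast
  qed
  then have "measure lam ({Z. prefix_code Z ?l = \<rho>\<^sub>0} - U) \<le> measure lam (?C \<inter> component m)"
    using sets by (intro lam.finite_measure_mono) auto
  moreover have "0 < measure lam ({Z. prefix_code Z ?l = \<rho>\<^sub>0} - U)"
    using \<rho>\<^sub>0(1) unfolding immortal_iff by (rule less_le_trans[rotated]) simp
  ultimately show ?thesis by simp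
qed

end

section \<open>Computable approximation of the indices\<close>

context effective_stages
begin

lemma component_index:
  obtains idx where "recursive 2 (\<lambda>e. idx (e 0) (e 1))"
    "\<And>m q. cyl (W (idx m q)) = {Z. \<exists>s. enumerated m q (prefix_code Z s) s}"
proof -
  \<comment> \<open>\<open>Suc x\<close> is the prefix code with a leading bit \<open>2 ^ s\<close>
    added, so the length \<open>s\<close> of a string is the position of the top bit of
    \<open>Suc x\<close>.\<close>
  define D where "D x m q \<longleftrightarrow> (\<exists>s<Suc x. 2 ^ s \<le> Suc x \<and> Suc x < 2 ^ Suc s \<and> enumerated m q (Suc x - 2 ^ s) s)" for x m q
  have "decidable 3 (\<lambda>e. D (e 0) (e 1) (e 2))"
    unfolding D_def enumerated_def selected_def alive_def removed_def len_def
    by (intro recursive_intros decidable_comp2[OF bad_decidable] recursive_proj) simp_all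
  then obtain idx where idx: "recursive 2 (\<lambda>e. idx (e 0) (e 1))" "\<And>m q. W (idx m q) = {\<sigma>. D (scode \<sigma>) m q}"
    using decidable_family_index by blast
  have D: "D (scode (map Z [0..<k])) m q \<longleftrightarrow> enumerated m q (prefix_code Z k) k" for Z k m q
  proof -
    let ?x = "scode (map Z [0..<k])"
    have x: "Suc ?x = prefix_code Z k + 2 ^ k" by (simp add: scode_prefix)
    have unique: "s = k" if "2 ^ s \<le> Suc ?x" "Suc ?x < 2 ^ Suc s" for s
    proof (rule ccontr)
      assume "s \<noteq> k"
      then consider "Suc s \<le> k" | "Suc k \<le> s" by linarith
      then show False
      proof cases
        case 1
        then have "(2 :: nat) ^ Suc s \<le> 2 ^ k" by (intro power_increasing) simp_all
        with that x show False by linarith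
      next
        case 2
        then have "(2 :: nat) ^ Suc k \<le> 2 ^ s" by (intro power_increasing) simp_all
        with that x prefix_code_less[of Z k] show False by simp
      qed
    qed
    have k: "k < Suc ?x" "2 ^ k \<le> Suc ?x" "Suc ?x < 2 ^ Suc k" "Suc ?x - 2 ^ k = prefix_code Z k"
      using trans_less_add2[OF less_exp, of k "prefix_code Z k"] prefix_code_less[of Z k] unfolding x by simp_all
    show ?thesis
    proof
      assume "D ?x m q"
      then obtain s where s: "2 ^ s \<le> Suc ?x" "Suc ?x < 2 ^ Suc s" "enumerated m q (Suc ?x - 2 ^ s) s"
        unfolding D_def by blast
      with unique[OF s(1,2)] k(4) show "enumerated m q (prefix_code Z k) k" by simp
    next
      assume "enumerated m q (prefix_code Z k) k"
      with k show "D ?x m q" unfolding D_def by (intro exI[of _ k]) simp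
    qed
  qed
  show thesis
    using that[OF idx(1)] by (simp add: cyl_eq idx(2) D)
qed

text \<open>The approximate index depends on the stage only through \<open>removed m t\<close>,
  which is nondecreasing and at most \<open>2 ^ Suc m\<close>; this bounds the number of
  changes.\<close>

lemma demuth_test_component: "demuth_test component"
proof -
  obtain idx where idx: "recursive 2 (\<lambda>e. idx (e 0) (e 1))"
    "\<And>m q. cyl (W (idx m q)) = {Z. \<exists>s. enumerated m q (prefix_code Z s) s}"
    using component_index by blast
  have removed_rec: "recursive 2 (\<lambda>e. removed (e 0) (e 1))"
    unfolding removed_def
    by (intro recursive_intros decidable_comp2[OF bad_decidable] recursive_proj) simp_all
  let ?g = "\<lambda>m t. idx m (removed m t)"
  have "recursive 2 ((\<lambda>i e. if i = 0 then e 0 else removed (e 0) (e 1)) i)" for i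
    using removed_rec by (cases "i = 0") (simp_all add: recursive_proj)
  from recursive_comp[OF idx(1), of 2 "\<lambda>i e. if i = 0 then e 0 else removed (e 0) (e 1)", OF this]
  have "recursive 2 (\<lambda>e. ?g (e 0) (e 1))" by simp
  then have g: "computable2 ?g" by (rule computable2_of_recursive)
  have h: "computable1 (\<lambda>m. 2 ^ Suc m)"
    by (intro computable1_of_recursive recursive_power2 recursive_Suc recursive_proj) simp
  have limit: "\<exists>t0. \<forall>t\<ge>t0. ?g m t = idx m (final_removed m)" for m
    using final_removed_le_iff[of m] removed_le_final[of m]
    by (intro exI[of _ "start m"]) (metis le_antisym)
  have changes: "finite {t. ?g m (Suc t) \<noteq> ?g m t} \<and> card {t. ?g m (Suc t) \<noteq> ?g m t} \<le> 2 ^ Suc m" for m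
  proof -
    have sub: "{t. ?g m (Suc t) \<noteq> ?g m t} \<subseteq> {t. removed m (Suc t) \<noteq> removed m t}" by auto
    note removed = mono_bounded_nat_changes[OF removed_mono removed_le, of m]
    show ?thesis
      using finite_subset[OF sub removed(1)] card_mono[OF removed(1) sub] removed(2) by simp
  qed
  have "emeasure lam (component m) \<le> ennreal ((1 / 2) ^ m)" for m
    unfolding lam.emeasure_eq_measure by (intro ennreal_leI measure_component)
  then show ?thesis
    unfolding demuth_test_def using g h limit changes idx(2)
    by (intro exI[of _ "\<lambda>m. idx m (final_removed m)"] exI[of _ ?g] exI[of _ "\<lambda>m. 2 ^ Suc m"])
      (simp add: component_def)
qed

end

lemma effectively_open_demuth_test:
  assumes "demuth_test S"
  shows "effectively_open (S m)"
proof -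
  from assms obtain f where "S m = cyl (W (f m))" unfolding demuth_test_def by blast
  then show ?thesis by (simp add: effectively_open_cyl_W)
qed

lemma sets_demuth_test: "demuth_test S \<Longrightarrow> S m \<in> sets lam"
  by (intro sets_prefix_open prefix_open_of_effectively_open effectively_open_demuth_test)

text \<open>Monotone stages of \<open>U\<close> instantiate the construction. The measurability that
  density asks for holds because components of Demuth tests are effectively open.\<close>

lemma demuth_test_dense_in_effectively_closed:
  assumes "effectively_open U"
  obtains S where "demuth_test S"
    "\<And>m Z k. 0 < measure lam (cylinder Z k - U) \<Longrightarrow> 0 < measure lam ((cylinder Z k - U) \<inter> S m)"
proof -
  obtain B where B: "decidable 2 (\<lambda>e. B (e 0) (e 1))" "U = {Z. \<exists>s. B (prefix_code Z s) s}"
    "\<And>Z s t. B (prefix_code Z s) s \<Longrightarrow> s \<le> t \<Longrightarrow> B (prefix_code Z t) t"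
    using effectively_open_stages[OF assms] by blast
  interpret effective_stages B
    by unfold_locales (use B in blast)+
  have U: "effective_stages.U B = U" unfolding U_def N_def B(2) by blast
  show thesis
    using that[OF demuth_test_component] component_dense sets_demuth_test[OF demuth_test_component]
    unfolding U by blast
qed

subsection \<open>Forcing with effectively closed sets of positive measure\<close>

text \<open>A program computing \<open>g\<close> determines the limit \<open>f\<close> and with it
  the whole test, and programs are countable.\<close>

lemma countable_demuth_tests: "countable {S. demuth_test S}"
proof -
  define T where "T c m = cyl (W (THE y. \<exists>t0. \<forall>t\<ge>t0. eval c [m, t] y))" for c m
  have "S \<in> range T" if "demuth_test S" for S
  proof -
    from that obtain f g where g: "computable2 g" "\<And>m. \<exists>t0. \<forall>t\<ge>t0. g m t = f m" "\<And>m. S m = cyl (W (f m))"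
      unfolding demuth_test_def by blast
    obtain c where c: "\<And>m t. eval c [m, t] (g m t)" using g(1) by (auto simp: computable2_def)
    have "(THE y. \<exists>t0. \<forall>t\<ge>t0. eval c [m, t] y) = f m" for m
    proof (rule the_equality)
      show "\<exists>t0. \<forall>t\<ge>t0. eval c [m, t] (f m)" using g(2)[of m] c by metis
      fix y assume "\<exists>t0. \<forall>t\<ge>t0. eval c [m, t] y"
      then obtain s where s: "\<And>t. s \<le> t \<Longrightarrow> eval c [m, t] y" by blast
      obtain r where r: "\<And>t. r \<le> t \<Longrightarrow> g m t = f m" using g(2)[of m] by blast
      show "y = f m"
        using s[of "max r s"] c[of m "max r s"] r[of "max r s"] eval_deterministic by fastforce
    qed
    then have "S = T c" unfolding T_def fun_eq_iff using g(3) by simp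
    then show ?thesis by blast
  qed
  moreover have "countable (UNIV :: recf set)"
    by (rule countableI'[of enc]) (auto intro: injI enc_injective)
  ultimately show ?thesis
    by (metis countable_image countable_subset mem_Collect_eq subsetI)
qed

text \<open>Choose \<open>m\<close> with \<open>(1 / 2) ^ m\<close> below the measure of
  \<open>Q\<close>; deleting the c.e. open set \<open>S m\<close> then leaves a condition.\<close>

lemma effectively_closed_positive_Diff_test:
  assumes Q: "effectively_closed_positive Q" and S: "demuth_test S"
  obtains Q' m where "effectively_closed_positive Q'" "Q' \<subseteq> Q" "Q' \<inter> S m = {}"
proof -
  have Q': "effectively_open (- Q)" "0 < measure lam Q" using Q by (auto simp: effectively_closed_positive_def)
  obtain m where m: "(1 / 2 :: real) ^ m < measure lam Q" using real_arch_pow_inv[OF Q'(2), of "1 / 2"] by auto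
  from S obtain n where n: "S m = cyl (W n)" "emeasure lam (S m) \<le> ennreal ((1 / 2) ^ m)"
    unfolding demuth_test_def by blast
  have "measure lam (S m) \<le> (1 / 2) ^ m" using n(2) by (simp add: lam.emeasure_eq_measure)
  moreover have "measure lam Q \<le> measure lam ((Q - S m) \<union> S m)"
    using sets_effectively_closed[OF Q'(1)] sets_demuth_test[OF S] by (intro lam.finite_measure_mono) auto
  moreover have "\<dots> \<le> measure lam (Q - S m) + measure lam (S m)"
    using sets_effectively_closed[OF Q'(1)] sets_demuth_test[OF S] by (intro measure_Un_le) auto
  ultimately have "0 < measure lam (Q - S m)" using m by linarith
  moreover have "- (Q - S m) = - Q \<union> cyl (W n)" using n(1) by blast
  ultimately have "effectively_closed_positive (Q - S m)"
    using effectively_open_Un[OF Q'(1) effectively_open_cyl_W] by (simp add: effectively_closed_positive_def)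
  then show thesis by (rule that) auto
qed

text \<open>Otherwise one could shrink an effectively closed set of positive measure step by step, avoiding the
  \<open>n\<close>-th Demuth test and making some \<open>F n j\<close> null at step \<open>n\<close>; a point in the supports of all these sets
  would be weakly Demuth random but lie in none of the \<open>G\<^sub>\<delta>\<close> sets.\<close>

lemma positive_in_some_G_delta:
  fixes F :: "nat \<Rightarrow> nat \<Rightarrow> (nat \<Rightarrow> bool) set"
  assumes F: "\<And>i j. prefix_open (F i j)" and cover: "\<And>Z. weakly_demuth_random Z \<Longrightarrow> Z \<in> (\<Union>i. \<Inter>j. F i j)"
  obtains Q i where "effectively_closed_positive Q"
    "\<And>Q' j. effectively_closed_positive Q' \<Longrightarrow> Q' \<subseteq> Q \<Longrightarrow> 0 < measure lam (Q' \<inter> F i j)"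
proof (rule ccontr)
  assume "\<not> thesis"
  with that have shrink: "\<exists>Q' j. effectively_closed_positive Q' \<and> Q' \<subseteq> Q \<and> measure lam (Q' \<inter> F i j) = 0"
    if "effectively_closed_positive Q" for Q i
    using that zero_less_measure_iff by metis
  define T where "T = from_nat_into {S. demuth_test S}"
  have T: "\<exists>n. T n = S" if "demuth_test S" for S
    using from_nat_into_surj[OF countable_demuth_tests, of S] that by (simp add: T_def)
  \<comment> \<open>\<open>from_nat_into\<close> returns members only for a nonempty set, hence the
    assumption that some test exists.\<close>
  have T_test: "demuth_test (T n)" if "demuth_test S" for n S
    using from_nat_into[of "{S. demuth_test S}" n] that unfolding T_def by blast
  have "\<exists>Q. \<forall>n. effectively_closed_positive (Q n) \<and>
    (Q (Suc n) \<subseteq> Q n \<and> (demuth_test (T n) \<longrightarrow> (\<exists>m. Q (Suc n) \<inter> T n m = {})) \<and>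
      (\<exists>j. measure lam (Q (Suc n) \<inter> F n j) = 0))"
  proof (rule dependent_nat_choice)
    \<comment> \<open>The empty complement arises as the set of reals whose code of length 0 differs
      from 0.\<close>
    have "effectively_closed_positive UNIV"
      using effectively_open_prefix_neq[of 0 0] lam.prob_space
      by (simp add: effectively_closed_positive_def prefix_code_def lam_def space_PiM PiE_UNIV_domain)
    then show "\<exists>Q. effectively_closed_positive Q" ..
  next
    fix Q n assume Q: "effectively_closed_positive Q"
    have "\<exists>Q1. effectively_closed_positive Q1 \<and> Q1 \<subseteq> Q \<and> (demuth_test (T n) \<longrightarrow> (\<exists>m. Q1 \<inter> T n m = {}))"
    proof (cases "demuth_test (T n)")
      case True
      show ?thesis by (rule effectively_closed_positive_Diff_test[OF Q True]) blast
    qed (use Q in blast)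
    then obtain Q1 where Q1: "effectively_closed_positive Q1" "Q1 \<subseteq> Q"
      "demuth_test (T n) \<longrightarrow> (\<exists>m. Q1 \<inter> T n m = {})" by blast
    obtain Q2 j where Q2: "effectively_closed_positive Q2" "Q2 \<subseteq> Q1" "measure lam (Q2 \<inter> F n j) = 0"
      using shrink[OF Q1(1)] by blast
    show "\<exists>Q2. effectively_closed_positive Q2 \<and> (Q2 \<subseteq> Q \<and>
      (demuth_test (T n) \<longrightarrow> (\<exists>m. Q2 \<inter> T n m = {})) \<and> (\<exists>j. measure lam (Q2 \<inter> F n j) = 0))"
      using Q1 Q2 by (intro exI[of _ Q2]) blast
  qed
  then obtain Q where Q: "\<And>n. effectively_closed_positive (Q n)" "\<And>n. Q (Suc n) \<subseteq> Q n"
    "\<And>n. demuth_test (T n) \<Longrightarrow> \<exists>m. Q (Suc n) \<inter> T n m = {}" "\<And>n. \<exists>j. measure lam (Q (Suc n) \<inter> F n j) = 0"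
    by blast
  have sets: "Q n \<in> sets lam" for n
    using Q(1)[of n] sets_effectively_closed by (simp add: effectively_closed_positive_def)
  have pos: "0 < measure lam (Q n)" for n
    using Q(1)[of n] by (simp add: effectively_closed_positive_def)
  obtain Z where Z: "\<And>n k. 0 < measure lam (Q n \<inter> cylinder Z k)"
    using common_support_point[of Q] sets Q(2) pos by blast
  \<comment> \<open>\<open>Q n\<close> is closed, so it contains every point all of whose cylinders
    it meets.\<close>
  have "Z \<in> Q n" for n
  proof (rule ccontr)
    assume "Z \<notin> Q n"
    moreover have "prefix_open (- Q n)"
      using Q(1)[of n] prefix_open_of_effectively_open by (simp add: effectively_closed_positive_def)
    ultimately obtain k where "cylinder Z k \<subseteq> - Q n" by (auto simp: prefix_open_def)
    then have "Q n \<inter> cylinder Z k = {}" by blast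
    with Z[of n k] show False by simp
  qed
  then have "weakly_demuth_random Z"
    unfolding weakly_demuth_random_def using T T_test Q(3) by (metis disjoint_iff)
  then obtain i where i: "\<And>j. Z \<in> F i j" using cover by blast
  \<comment> \<open>Step \<open>i\<close> made some \<open>F i j\<close> null in
    \<open>Q (Suc i)\<close>, but this open set contains a cylinder around \<open>Z\<close>, where
    \<open>Q (Suc i)\<close> has positive measure.\<close>
  obtain j where j: "measure lam (Q (Suc i) \<inter> F i j) = 0" using Q(4) by blast
  obtain k where "cylinder Z k \<subseteq> F i j" using F[of i j] i[of j] by (auto simp: prefix_open_def)
  then have "measure lam (Q (Suc i) \<inter> cylinder Z k) \<le> measure lam (Q (Suc i) \<inter> F i j)"
    using sets sets_prefix_open[OF F] by (intro lam.finite_measure_mono) auto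
  with j Z[of "Suc i" k] show False by simp
qed

theorem mainTheorem8:
  shows "\<not> boldface_Sigma03 {Z. weakly_demuth_random Z}"
proof
  assume "boldface_Sigma03 {Z. weakly_demuth_random Z}"
  then obtain F :: "nat \<Rightarrow> nat \<Rightarrow> (nat \<Rightarrow> bool) set" where "(\<forall>i j. openin cantor_top (F i j)) \<and>
      {Z. weakly_demuth_random Z} = (\<Union>i. \<Inter>j. F i j)"
    unfolding boldface_Sigma03_def ..
  then have F_open: "\<forall>i j. openin cantor_top (F i j)"
    and random: "{Z. weakly_demuth_random Z} = (\<Union>i. \<Inter>j. F i j)"
    by simp_all
  have F: "prefix_open (F i j)" for i j by (rule prefix_open_of_openin) (simp add: F_open)
  have "Z \<in> (\<Union>i. \<Inter>j. F i j)" if "weakly_demuth_random Z" for Z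
    using that unfolding random[symmetric] by simp
  then obtain Q i where Q: "effectively_closed_positive Q"
    "\<And>Q' j. effectively_closed_positive Q' \<Longrightarrow> Q' \<subseteq> Q \<Longrightarrow> 0 < measure lam (Q' \<inter> F i j)"
    using positive_in_some_G_delta[of F, OF F] by blast
  then have Q_open: "effectively_open (- Q)" by (simp add: effectively_closed_positive_def)
  then have sets_Q: "Q \<in> sets lam" by (rule sets_effectively_closed)
  obtain S where S: "demuth_test S"
    "\<And>m Z k. 0 < measure lam (Q \<inter> cylinder Z k) \<Longrightarrow> 0 < measure lam (Q \<inter> cylinder Z k \<inter> S m)"
  proof (rule demuth_test_dense_in_effectively_closed[OF Q_open])
    have "cylinder Z k - - Q = Q \<inter> cylinder Z k" for Z k by blast
    then show thesis if "demuth_test S" "\<And>m Z k. 0 < measure lam (cylinder Z k - - Q) \<Longrightarrow> 0 < measure lam ((cylinder Z k - - Q) \<inter> S m)" for S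
      using that \<open>\<And>S. \<lbrakk>demuth_test S; \<And>m Z k. 0 < measure lam (Q \<inter> cylinder Z k) \<Longrightarrow> 0 < measure lam (Q \<inter> cylinder Z k \<inter> S m)\<rbrakk> \<Longrightarrow> thesis\<close> by simp
  qed
  have S_open: "prefix_open (S n)" for n
    by (intro prefix_open_of_effectively_open effectively_open_demuth_test S(1))
  \<comment> \<open>A pair represents the cylinder of its real and length; live cylinders are those
    that meet \<open>Q\<close> in positive measure.\<close>
  define live where "live p \<longleftrightarrow> 0 < measure lam (Q \<inter> cylinder (fst p) (snd p))" for p :: "(nat \<Rightarrow> bool) \<times> nat"
  have "\<exists>p. \<forall>n. live (p n) \<and> (snd (p n) < snd (p (Suc n)) \<and>
      prefix_code (fst (p (Suc n))) (snd (p n)) = prefix_code (fst (p n)) (snd (p n)) \<and>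
      cylinder (fst (p (Suc n))) (snd (p (Suc n))) \<subseteq> F i n \<inter> S n)"
  proof (rule dependent_nat_choice)
    \<comment> \<open>A cylinder of length 0 is the whole space, whichever real represents
      it.\<close>
    have "live (undefined, 0)"
      using Q(1) by (simp add: live_def effectively_closed_positive_def prefix_code_def)
    then show "\<exists>p. live p" ..
  next
    fix p n assume p: "live p"
    obtain Z k where Zk: "p = (Z, k)" by fastforce
    \<comment> \<open>The part of \<open>Q\<close> in the current cylinder is again a condition, so
      by the choice of \<open>Q\<close> it meets \<open>F i n\<close> in positive measure.\<close>
    let ?Q' = "Q \<inter> cylinder Z k"
    have "- ?Q' = - Q \<union> {Y. prefix_code Y k \<noteq> prefix_code Z k}" by blast
    then have "effectively_open (- ?Q')"
      using effectively_open_Un[OF Q_open effectively_open_prefix_neq] by simp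
    then have "effectively_closed_positive ?Q'" using p Zk by (simp add: effectively_closed_positive_def live_def)
    then have pos: "0 < measure lam (?Q' \<inter> F i n)" by (intro Q(2)) auto
    have "?Q' \<in> sets lam" using sets_Q by (intro sets.Int sets_prefix_eq)
    \<comment> \<open>The bound \<open>Suc k\<close> forces the lengths to increase strictly, as the
      limit construction requires.\<close>
    obtain Z1 k1 where 1: "Suc k \<le> k1" "cylinder Z1 k1 \<subseteq> F i n" "0 < measure lam (?Q' \<inter> cylinder Z1 k1)"
      by (rule positive_cylinder[OF F \<open>?Q' \<in> sets lam\<close> pos, of "Suc k"]) (rule that)
    have "measure lam (?Q' \<inter> cylinder Z1 k1) \<le> measure lam (Q \<inter> cylinder Z1 k1)"
      using sets_Q by (intro lam.finite_measure_mono) auto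
    with 1(3) have "0 < measure lam (Q \<inter> cylinder Z1 k1)" by linarith
    then have pos: "0 < measure lam (Q \<inter> cylinder Z1 k1 \<inter> S n)" by (rule S(2))
    have "Q \<inter> cylinder Z1 k1 \<in> sets lam" using sets_Q by (intro sets.Int sets_prefix_eq)
    obtain Z2 k2 where 2: "k1 \<le> k2" "cylinder Z2 k2 \<subseteq> S n" "0 < measure lam (Q \<inter> cylinder Z1 k1 \<inter> cylinder Z2 k2)"
      by (rule positive_cylinder[OF S_open \<open>Q \<inter> cylinder Z1 k1 \<in> sets lam\<close> pos, of k1]) (rule that)
    \<comment> \<open>Sets of positive measure contain points; such common points show that the
      successive cylinders are nested.\<close>
    have nonempty: "A \<noteq> {}" if "0 < measure lam A" for A using that by auto
    obtain X where X: "prefix_code X k = prefix_code Z k" "prefix_code X k1 = prefix_code Z1 k1"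
      using nonempty[OF 1(3)] by blast
    obtain Y where Y: "prefix_code Y k1 = prefix_code Z1 k1" "prefix_code Y k2 = prefix_code Z2 k2"
      using nonempty[OF 2(3)] by blast
    have Z21: "prefix_code Z2 k1 = prefix_code Z1 k1" using Y prefix_code_eq_mono[OF Y(2) 2(1)] by simp
    have "prefix_code Z1 k = prefix_code Z k" using X prefix_code_eq_mono[OF X(2), of k] 1(1) by simp
    then have "prefix_code Z2 k = prefix_code Z k" using prefix_code_eq_mono[OF Z21, of k] 1(1) by simp
    moreover have "cylinder Z2 k2 \<subseteq> F i n"
    proof -
      have "cylinder Z2 k2 \<subseteq> cylinder Z1 k1"
      proof (intro Collect_mono impI)
        fix V assume "prefix_code V k2 = prefix_code Z2 k2"
        from prefix_code_eq_mono[OF this 2(1)] Z21 show "prefix_code V k1 = prefix_code Z1 k1" by simp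
      qed
      with 1(2) show ?thesis by blast
    qed
    moreover have "live (Z2, k2)"
    proof -
      have "measure lam (Q \<inter> cylinder Z1 k1 \<inter> cylinder Z2 k2) \<le> measure lam (Q \<inter> cylinder Z2 k2)"
        using sets_Q by (intro lam.finite_measure_mono) auto
      with 2(3) show ?thesis by (simp add: live_def)
    qed
    ultimately show "\<exists>p'. live p' \<and> (snd p < snd p' \<and>
        prefix_code (fst p') (snd p) = prefix_code (fst p) (snd p) \<and>
        cylinder (fst p') (snd p') \<subseteq> F i n \<inter> S n)"
      using 1(1) 2(1,2) Zk by (intro exI[of _ "(Z2, k2)"]) auto
  qed
  then obtain p where p: "\<And>n. snd (p n) < snd (p (Suc n))"
      "\<And>n. prefix_code (fst (p (Suc n))) (snd (p n)) = prefix_code (fst (p n)) (snd (p n))"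
      "\<And>n. cylinder (fst (p (Suc n))) (snd (p (Suc n))) \<subseteq> F i n \<inter> S n"
    by blast
  obtain Z where Z: "\<And>n. prefix_code Z (snd (p n)) = prefix_code (fst (p n)) (snd (p n))"
    using nested_cylinders_limit[of "\<lambda>n. fst (p n)" "\<lambda>n. snd (p n)"] p(1,2) by blast
  have "Z \<in> F i n \<inter> S n" for n using p(3)[of n] Z[of "Suc n"] by blast
  then have "Z \<in> (\<Union>i. \<Inter>j. F i j)" "\<not> weakly_demuth_random Z"
    unfolding weakly_demuth_random_def using S(1) by blast+
  with random show False by blast
qed

end
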